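(* Let the generators $\phi_1,\dots,\phi_6$, the scaling functions $\phi_{j,k}$ ($j,k\in\mathbb Z$) and the spaces $V_j$ be constructed as in the context. Then: a) The generators $\phi_i$, $i=1,\dots,6$, and the scaling functions $\phi_{j,k}$, $j,k\in\mathbb Z$, are cubic splines belonging to $C^1(\mathbb R)$. b) The sequence $\{V_j\}_{j\in\mathbb Z}$ is an orthogonal multiresolution analysis of $L^2(\mathbb R)$ (of multiplicity 6, generated by $\phi_1,\dots,\phi_6$) satisfying $\tilde V_q\subset V_0\subset\tilde V_{q+n}$ for some $q\ge0$ and $n\ge1$.
   Context: $\langle\cdot,\cdot\rangle$, $\|\cdot\|$ are the inner product and norm of real $L^2(\mathbb R)$; $\mathcal X\ominus\mathcal Y$ is the $L^2$-orthogonal complement of $\mathcal Y$ in $\mathcal X$; $\chi_{[0,1]}$ is an indicator function. Hermite cubics. $\xi_1(x)=(x+1)^2(1-2x)$ on $[-1,0]$, $(1-x)^2(1+2x)$ on $[0,1]$, $0$ otherwise; $\xi_2(x)=(x+1)^2x$ on $[-1,0]$, $(1-x)^2x$ on $[0,1]$, $0$ otherwise. $\xi_{j,2k+l-1}(x)=2^{j/2}\xi_l(2^jx-k)$ for $l=1,2$, and $\tilde V_j=\overline{\operatorname{span}}\{\xi_{j,k}:k\in\mathbb Z\}$. Generators. $\phi_1=\xi_{1,2}/\|\xi_{1,2}\|$, $\phi_2=\xi_{1,3}/\|\xi_{1,3}\|$. $\mathcal A_0=\operatorname{span}\{\xi_{1,2},\xi_{1,3}\}$, $\mathcal A_1=\operatorname{span}\{\xi_{2,k}:k=2,\dots,7\}$.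 $\mathcal B_0=\operatorname{span}(\{\xi_{1,0}\chi_{[0,1]},\xi_{1,1}\chi_{[0,1]}\}\cup\mathcal A_0)$, $\mathcal B_1=\operatorname{span}(\{\xi_{1,4}\chi_{[0,1]},\xi_{1,5}\chi_{[0,1]}\}\cup\mathcal A_0)$, $\mathcal C_h=\mathcal B_h\ominus\mathcal A_0$ for $h=0,1$. $\phi_3,\phi_4$ form an orthonormal basis of a (two-dimensional) subspace $W\subset\mathcal A_1\ominus\mathcal A_0$ such that $(I-P_W)\mathcal C_0\perp(I-P_W)\mathcal C_1$, where $P_W$ is the orthogonal projection onto $W$. Finally $$g_5=\xi_{1,0}-\sum_{j=1}^4\langle\xi_{1,0},\phi_j\rangle\phi_j-\sum_{j=1}^4\langle\xi_{1,0},\phi_j(\cdot+1)\rangle\phi_j(\cdot+1),\quad\phi_5=g_5/\|g_5\|,$$ $$g_6=\xi_{1,1}-\sum_{j=1}^5\langle\xi_{1,1},\phi_j\rangle\phi_j-\sum_{j=1}^5\langle\xi_{1,1},\phi_j(\cdot+1)\rangle\phi_j(\cdot+1),\quad\phi_6=g_6/\|g_6\|.$$ Scaling functions. For $j,k\in\mathbb Z$: $\phi_{j,6k+l}(x)=2^{j/2}\phi_l(2^jx-k)$ for $l=1,2,3,4$, and $\phi_{j,6k+l}(x)=2^{j/2}\phi_l(2^jx-k-1)$ for $l=5,6$; $V_j=\overline{\operatorname{span}}\{\phi_{j,k}:k\in\mathbb Z\}$. Multiresolution analysis (MRA) of multiplicity $p$: closed subspaces $V_j\subset L^2(\mathbb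 R)$, $j\in\mathbb Z$, with (i) $V_j\subset V_{j+1}$; (ii) $f\in V_j$ iff $f(2^{-j}\cdot)\in V_0$; (iii) $\bigcup_jV_j$ dense in $L^2(\mathbb R)$; (iv) $\bigcap_jV_j=\{0\}$; (v) there are functions $\phi_1,\dots,\phi_p$ such that $\{\phi_i(\cdot-k):i=1,\dots,p,\ k\in\mathbb Z\}$ is a Riesz basis of $V_0$. It is called orthogonal if this system is an orthonormal basis of $V_0$. *)

theory Defs
  imports "HOL-Analysis.Analysis" "HOL-Library.Function_Algebras"
    "HOL-Computational_Algebra.Polynomial"
begin

text \<open>Real functions form a real vector space under the pointwise operations; this makes
  \<^const>\<open>span\<close> and \<^const>\<open>subspace\<close> available for them.\<close>

instantiation "fun" :: (type, real_vector) real_vector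
begin

definition "r *\<^sub>R f = (\<lambda>x. r *\<^sub>R f x)"

instance
  by standard (auto simp: scaleR_fun_def plus_fun_def fun_eq_iff scaleR_add_right scaleR_add_left)

end

lemma scaleR_fun_apply [simp]: "(r *\<^sub>R f) x = r *\<^sub>R f x"
  by (simp add: scaleR_fun_def)


section \<open>The space of square integrable functions\<close>

text \<open>Elements of $L^2$ are represented by (Borel) functions. Two functions that agree almost
  everywhere represent the same element, and \<open>l2_closure\<close> is closed under passing
  to another representative. Note that \<^const>\<open>closure\<close> on functions refers to
  the product topology and therefore must not be used here.\<close>

definition L2 :: "(real \<Rightarrow> real) set" where
  "L2 = {f \<in> borel_measurable lborel. integrable lborel (\<lambda>x. (f x)\<^sup>2)}"

definition l2_inner :: "(real \<Rightarrow> real) \<Rightarrow> (real \<Rightarrow> real) \<Rightarrow> real" where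
  "l2_inner f g = (LINT x|lborel. f x * g x)"

definition l2_norm :: "(real \<Rightarrow> real) \<Rightarrow> real" where
  "l2_norm f = sqrt (l2_inner f f)"

definition l2_closure :: "(real \<Rightarrow> real) set \<Rightarrow> (real \<Rightarrow> real) set" where
  "l2_closure S = {f \<in> L2. \<forall>e>0. \<exists>g\<in>S \<inter> L2. l2_norm (f - g) < e}"

definition closed_l2_subspace :: "(real \<Rightarrow> real) set \<Rightarrow> bool" where
  "closed_l2_subspace V \<longleftrightarrow> subspace V \<and> l2_closure V = V"

definition l2_ominus :: "(real \<Rightarrow> real) set \<Rightarrow> (real \<Rightarrow> real) set \<Rightarrow> (real \<Rightarrow> real) set"
    (infixl "\<ominus>\<^sub>2" 65) where
  "X \<ominus>\<^sub>2 Y = {f \<in> X. \<forall>g\<in>Y. l2_inner f g = 0}"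

text \<open>The orthogonal projection is determined up to equality almost everywhere, hence
  \<open>SOME\<close> rather than \<open>THE\<close>.\<close>

definition l2_proj :: "(real \<Rightarrow> real) set \<Rightarrow> (real \<Rightarrow> real) \<Rightarrow> real \<Rightarrow> real" where
  "l2_proj W f = (SOME g. g \<in> W \<and> (\<forall>h\<in>W. l2_inner (f - g) h = 0))"

definition orthonormal_system :: "'i set \<Rightarrow> ('i \<Rightarrow> real \<Rightarrow> real) \<Rightarrow> bool" where
  "orthonormal_system I b \<longleftrightarrow>
     b ` I \<subseteq> L2 \<and> (\<forall>i\<in>I. \<forall>j\<in>I. l2_inner (b i) (b j) = (if i = j then 1 else 0))"

definition orthonormal_basis_of :: "(real \<Rightarrow> real) set \<Rightarrow> 'i set \<Rightarrow> ('i \<Rightarrow> real \<Rightarrow> real) \<Rightarrow> bool" where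
  "orthonormal_basis_of H I b \<longleftrightarrow> orthonormal_system I b \<and> l2_closure (span (b ` I)) = H"

definition riesz_basis_of :: "(real \<Rightarrow> real) set \<Rightarrow> 'i set \<Rightarrow> ('i \<Rightarrow> real \<Rightarrow> real) \<Rightarrow> bool" where
  "riesz_basis_of H I b \<longleftrightarrow>
     b ` I \<subseteq> L2 \<and> l2_closure (span (b ` I)) = H \<and>
     (\<exists>A>0. \<exists>B>0. \<forall>F c. finite F \<and> F \<subseteq> I \<longrightarrow>
        A * (\<Sum>i\<in>F. (c i)\<^sup>2) \<le> (l2_norm (\<Sum>i\<in>F. c i *\<^sub>R b i))\<^sup>2 \<and>
        (l2_norm (\<Sum>i\<in>F. c i *\<^sub>R b i))\<^sup>2 \<le> B * (\<Sum>i\<in>F. (c i)\<^sup>2))"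


section \<open>Multiresolution analyses\<close>

definition integer_translates :: "(nat \<Rightarrow> real \<Rightarrow> real) \<Rightarrow> nat \<times> int \<Rightarrow> real \<Rightarrow> real" where
  "integer_translates \<phi> = (\<lambda>(i, k) x. \<phi> i (x - of_int k))"

text \<open>The intersection condition says that only the null functions, i.e. the representatives of
  the zero element of $L^2$, lie in all \<open>V j\<close>.\<close>

definition mra :: "nat \<Rightarrow> (nat \<Rightarrow> real \<Rightarrow> real) \<Rightarrow> (int \<Rightarrow> (real \<Rightarrow> real) set) \<Rightarrow> bool" where
  "mra p \<phi> V \<longleftrightarrow>
     (\<forall>j. closed_l2_subspace (V j)) \<and>
     (\<forall>j. V j \<subseteq> V (j + 1)) \<and>
     (\<forall>j f. f \<in> V j \<longleftrightarrow> (\<lambda>x. f (2 powi (- j) * x)) \<in> V 0) \<and>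
     l2_closure (\<Union>j. V j) = L2 \<and>
     (\<Inter>j. V j) = {f \<in> L2. AE x in lborel. f x = 0} \<and>
     riesz_basis_of (V 0) ({1..p} \<times> UNIV) (integer_translates \<phi>)"

definition orthogonal_mra :: "nat \<Rightarrow> (nat \<Rightarrow> real \<Rightarrow> real) \<Rightarrow> (int \<Rightarrow> (real \<Rightarrow> real) set) \<Rightarrow> bool" where
  "orthogonal_mra p \<phi> V \<longleftrightarrow>
     mra p \<phi> V \<and> orthonormal_basis_of (V 0) ({1..p} \<times> UNIV) (integer_translates \<phi>)"


section \<open>Cubic splines\<close>

text \<open>A function that is given by a polynomial of degree at most 3 between any two
  neighbouring members of a finite set \<open>K\<close> of knots, as well as to the left and to the
  right of all knots. Smoothness is stated separately.\<close>

definition cubic_spline :: "(real \<Rightarrow> real) \<Rightarrow> bool" where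
  "cubic_spline f \<longleftrightarrow>
     (\<exists>K. finite K \<and>
        (\<forall>a b. a < b \<and> {a<..<b} \<inter> K = {} \<longrightarrow>
           (\<exists>q :: real poly. degree q \<le> 3 \<and> (\<forall>x\<in>{a..b}. f x = poly q x))))"


section \<open>Hermite cubics and the scaling functions\<close>

definition xi1 :: "real \<Rightarrow> real" where
  "xi1 x = (if x \<in> {-1..0} then (x + 1)\<^sup>2 * (1 - 2 * x)
            else if x \<in> {0..1} then (1 - x)\<^sup>2 * (1 + 2 * x) else 0)"

definition xi2 :: "real \<Rightarrow> real" where
  "xi2 x = (if x \<in> {-1..0} then (x + 1)\<^sup>2 * x
            else if x \<in> {0..1} then (1 - x)\<^sup>2 * x else 0)"

text \<open>The index is \<open>m = 2 * k + l - 1\<close> with \<open>l = 1\<close> for even and \<open>l = 2\<close> for odd \<open>m\<close>.\<close>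

definition xi :: "int \<Rightarrow> int \<Rightarrow> real \<Rightarrow> real" where
  "xi j m x = 2 powr (of_int j / 2) *
     (if even m then xi1 else xi2) (2 powi j * x - of_int (m div 2))"

definition Vtilde :: "int \<Rightarrow> (real \<Rightarrow> real) set" where
  "Vtilde j = l2_closure (span (range (xi j)))"

definition A0 :: "(real \<Rightarrow> real) set" where
  "A0 = span {xi 1 2, xi 1 3}"

definition A1 :: "(real \<Rightarrow> real) set" where
  "A1 = span (xi 2 ` {2..7})"

definition restrict01 :: "(real \<Rightarrow> real) \<Rightarrow> real \<Rightarrow> real" where
  "restrict01 f x = f x * indicator {0..1} x"

definition B0 :: "(real \<Rightarrow> real) set" where
  "B0 = span ({restrict01 (xi 1 0), restrict01 (xi 1 1)} \<union> A0)"

definition B1 :: "(real \<Rightarrow> real) set" where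
  "B1 = span ({restrict01 (xi 1 4), restrict01 (xi 1 5)} \<union> A0)"

definition C0 :: "(real \<Rightarrow> real) set" where
  "C0 = B0 \<ominus>\<^sub>2 A0"

definition C1 :: "(real \<Rightarrow> real) set" where
  "C1 = B1 \<ominus>\<^sub>2 A0"

text \<open>The index is \<open>m = 6 * k + l\<close> with \<open>l \<in> {1..6}\<close>; the functions with \<open>l = 5\<close> and \<open>l = 6\<close>
  are shifted by one further integer step.\<close>

definition scaling_fun :: "(nat \<Rightarrow> real \<Rightarrow> real) \<Rightarrow> int \<Rightarrow> int \<Rightarrow> real \<Rightarrow> real" where
  "scaling_fun \<phi> j m x =
     (let k = (m - 1) div 6; l = nat ((m - 1) mod 6) + 1
      in 2 powr (of_int j / 2) *
         \<phi> l (2 powi j * x - of_int k - (if l \<le> 4 then 0 else 1)))"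

definition scaling_space :: "(nat \<Rightarrow> real \<Rightarrow> real) \<Rightarrow> int \<Rightarrow> (real \<Rightarrow> real) set" where
  "scaling_space \<phi> j = l2_closure (span (range (scaling_fun \<phi> j)))"

end

theory Submission
  imports Defs
begin

text \<open>The span of the generators and their translates lies between \<open>span (range (xi 1))\<close> and
  \<open>span (range (xi 2))\<close>; together with the refinement equation of the Hermite cubics and the fact that
  dilation by 2 is a multiple of an isometry this gives nestedness and the inclusions
  \<open>Vtilde 1 \<subseteq> scaling_space \<phi> 0 \<subseteq> Vtilde 2\<close>. Up to a null set, \<open>\<phi> 5\<close> and \<open>\<phi> 6\<close> consist of a half on
  \<open>[0, 1]\<close> and a half on \<open>[-1, 0]\<close>. On \<open>[0, 1]\<close> the halves of \<open>\<phi> i\<close> and of a translate of \<open>\<phi> k\<close> come from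
  \<open>(I - P_W) C_0\<close> and \<open>(I - P_W) C_1\<close>, so the choice of \<open>W\<close> makes all translates orthonormal.
  Density holds because indicators of intervals are limits of sums of \<open>xi1 (2^n x - k)\<close>, and the
  intersection is trivial because functions in \<open>V_0\<close> satisfy \<open>|f| \<le> C * l2_norm f\<close> almost everywhere.\<close>

section \<open>The inner product\<close>

text \<open>The functions \<open>xi 1 0\<close> and \<open>xi 1 1\<close> straddle 0 and meet
  \<open>\<phi> 1\<close> to \<open>\<phi> 4\<close> on the unit intervals on both sides.
  Subtracting these components spreads \<open>g5\<close> and \<open>g6\<close> over [-1, 1], so
  neighbouring translates overlap on a whole unit interval. The Gram-Schmidt formulas do not correct
  that overlap: the only term of this kind, the shifted \<open>\<phi> 5\<close> in
  \<open>g6\<close>, has coefficient 0. The hypothesis on \<open>W\<close> has to do this work. It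
  becomes usable because \<open>W\<close> is orthogonal to \<open>A0\<close>, so that removing the
  components along \<open>\<phi> 1\<close> to \<open>\<phi> 4\<close> amounts to removing first
  those in \<open>A0\<close> and then those in \<open>W\<close>. Cutting at 0 destroys continuity.
  Hence two descriptions of \<open>\<phi> 5\<close> and \<open>\<phi> 6\<close> are kept: the uncut
  formula yields smoothness, pointwise values and membership in spans, while the cut form holds only
  almost everywhere and serves inner products. The uncut formula also shows that \<open>g5\<close>
  and \<open>g6\<close> are nonzero, without which their normalisation would be meaningless.\<close>

lemma L2_measurable [measurable_dest]: "f \<in> L2 \<Longrightarrow> f \<in> borel_measurable borel"
  by (simp add: L2_def)

lemma L2_integrable_square: "f \<in> L2 \<Longrightarrow> integrable lborel (\<lambda>x. (f x)\<^sup>2)"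
  by (simp add: L2_def)

lemma L2_integrable_mult:
  assumes "f \<in> L2" "g \<in> L2"
  shows "integrable lborel (\<lambda>x. f x * g x)"
proof (rule Bochner_Integration.integrable_bound)
  show "integrable lborel (\<lambda>x. (f x)\<^sup>2 + (g x)\<^sup>2)"
    using assms by (simp add: L2_def)
  show "(\<lambda>x. f x * g x) \<in> borel_measurable lborel"
    using assms[THEN L2_measurable] by simp
  have "\<bar>a * b\<bar> \<le> a\<^sup>2 + b\<^sup>2" for a b :: real
    using sum_squares_bound[of "\<bar>a\<bar>" "\<bar>b\<bar>"] abs_ge_zero[of "a * b"] unfolding abs_mult power2_abs by linarith
  then show "AE x in lborel. norm (f x * g x) \<le> norm ((f x)\<^sup>2 + (g x)\<^sup>2)"
    by simp
qed

lemma L2_bound: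
  assumes "f \<in> borel_measurable lborel" "g \<in> L2" "\<And>x. \<bar>f x\<bar> \<le> \<bar>g x\<bar>"
  shows "f \<in> L2"
proof -
  have "integrable lborel (\<lambda>x. (f x)\<^sup>2)"
  proof (rule Bochner_Integration.integrable_bound[OF L2_integrable_square[OF assms(2)]])
    show "AE x in lborel. norm ((f x)\<^sup>2) \<le> norm ((g x)\<^sup>2)"
      using assms(3) by (simp add: abs_le_square_iff)
  qed (use assms(1) in simp)
  then show ?thesis using assms(1) by (simp add: L2_def)
qed

lemma sum_fun_apply: "(\<Sum>i\<in>F. f i) x = (\<Sum>i\<in>F. f i x)"
  by (induction F rule: infinite_finite_induct) simp_all

lemma subspace_L2: "subspace L2"
proof (rule subspaceI)
  show "0 \<in> L2" by (simp add: L2_def zero_fun_def)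
next
  fix f g assume fg: "f \<in> L2" "g \<in> L2"
  have "integrable lborel (\<lambda>x. (f x)\<^sup>2 + (g x)\<^sup>2 + 2 * (f x * g x))"
    using fg L2_integrable_mult[OF fg] by (simp add: L2_def)
  moreover have "(\<lambda>x. (f x)\<^sup>2 + (g x)\<^sup>2 + 2 * (f x * g x)) = (\<lambda>x. ((f + g) x)\<^sup>2)"
    by (simp add: fun_eq_iff power2_sum)
  ultimately show "f + g \<in> L2"
    using fg[THEN L2_measurable] by (simp add: L2_def plus_fun_def)
next
  fix c f assume f: "f \<in> L2"
  then show "c *\<^sub>R f \<in> L2"
    using L2_measurable[OF f] by (simp add: L2_def scaleR_fun_def power_mult_distrib)
qed

lemmas L2_0 [simp] = subspace_0[OF subspace_L2]
lemmas L2_add [intro] = subspace_add[OF subspace_L2]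
lemmas L2_diff [intro] = subspace_diff[OF subspace_L2]
lemmas L2_scaleR [intro] = subspace_scale[OF subspace_L2]
lemmas L2_sum [intro] = subspace_sum[OF subspace_L2]

lemma l2_inner_commute: "l2_inner f g = l2_inner g f"
  by (simp add: l2_inner_def mult.commute)

lemma l2_inner_add_left:
  assumes "f \<in> L2" "g \<in> L2" "h \<in> L2"
  shows "l2_inner (f + g) h = l2_inner f h + l2_inner g h"
  unfolding l2_inner_def plus_fun_apply distrib_right
  using assms by (simp add: L2_integrable_mult)

lemma l2_inner_diff_left:
  assumes "f \<in> L2" "g \<in> L2" "h \<in> L2"
  shows "l2_inner (f - g) h = l2_inner f h - l2_inner g h"
  unfolding l2_inner_def minus_apply left_diff_distrib
  using assms by (simp add: L2_integrable_mult)

lemma l2_inner_scaleR_left [simp]: "l2_inner (c *\<^sub>R f) h = c * l2_inner f h"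
  by (simp add: l2_inner_def mult.assoc)

lemma l2_inner_zero_left [simp]: "l2_inner 0 h = 0"
  by (simp add: l2_inner_def)

lemma l2_inner_scaleR_right [simp]: "l2_inner h (c *\<^sub>R f) = c * l2_inner h f"
  by (simp add: l2_inner_def mult.left_commute)

lemma l2_inner_zero_right [simp]: "l2_inner h 0 = 0"
  by (simp add: l2_inner_def)

lemma l2_inner_add_right:
  assumes "f \<in> L2" "g \<in> L2" "h \<in> L2"
  shows "l2_inner h (f + g) = l2_inner h f + l2_inner h g"
  using l2_inner_add_left[OF assms] by (simp add: l2_inner_commute)

lemma l2_inner_diff_right:
  assumes "f \<in> L2" "g \<in> L2" "h \<in> L2"
  shows "l2_inner h (f - g) = l2_inner h f - l2_inner h g"
  using l2_inner_diff_left[OF assms] by (simp add: l2_inner_commute)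

lemma l2_inner_sum_left:
  assumes "\<And>i. i \<in> F \<Longrightarrow> f i \<in> L2" "h \<in> L2"
  shows "l2_inner (\<Sum>i\<in>F. f i) h = (\<Sum>i\<in>F. l2_inner (f i) h)"
  using assms
  by (induction F rule: infinite_finite_induct) (simp_all add: l2_inner_add_left L2_sum)

lemma l2_inner_sum_right:
  assumes "\<And>i. i \<in> F \<Longrightarrow> f i \<in> L2" "h \<in> L2"
  shows "l2_inner h (\<Sum>i\<in>F. f i) = (\<Sum>i\<in>F. l2_inner h (f i))"
  using l2_inner_sum_left[OF assms] by (simp add: l2_inner_commute)

lemma l2_inner_self_nonneg [simp]: "0 \<le> l2_inner f f"
  by (simp add: l2_inner_def)

lemma l2_norm_nonneg [simp]: "0 \<le> l2_norm f"
  by (simp add: l2_norm_def)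

lemma l2_norm_square: "(l2_norm f)\<^sup>2 = l2_inner f f"
  by (simp add: l2_norm_def)

lemma l2_norm_scaleR: "l2_norm (c *\<^sub>R f) = \<bar>c\<bar> * l2_norm f"
  by (simp add: l2_norm_def real_sqrt_mult mult.assoc[symmetric])

lemma l2_norm_zero [simp]: "l2_norm 0 = 0"
  by (simp add: l2_norm_def)

lemma l2_norm_uminus [simp]: "l2_norm (- f) = l2_norm f"
  by (simp add: l2_norm_def l2_inner_def)

lemma l2_norm_minus_commute: "l2_norm (f - g) = l2_norm (g - f)"
  using l2_norm_uminus[of "f - g"] by simp

text \<open>On functions, as opposed to classes, \<open>l2_inner\<close> is only positive
  semidefinite, so the case of zero norm is a genuine one. Both cases evaluate the nonnegative
  quadratic form of \<open>s *\<^sub>R f + t *\<^sub>R g\<close>.\<close>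

lemma l2_Cauchy_Schwarz:
  assumes "f \<in> L2" "g \<in> L2"
  shows "\<bar>l2_inner f g\<bar> \<le> l2_norm f * l2_norm g"
proof -
  let ?a = "l2_inner f f" and ?b = "l2_inner f g" and ?c = "l2_inner g g"
  have "0 \<le> l2_inner (s *\<^sub>R f + t *\<^sub>R g) (s *\<^sub>R f + t *\<^sub>R g)" for s t by simp
  then have q: "0 \<le> s\<^sup>2 * ?a + 2 * s * t * ?b + t\<^sup>2 * ?c" for s t
    using assms by (simp add: l2_inner_add_left l2_inner_add_right L2_add L2_scaleR l2_inner_commute[of g f]
        power2_eq_square algebra_simps)
  have "?b\<^sup>2 \<le> ?a * ?c"
  proof (cases "?a = 0")
    case True
    have "?b = 0"
    proof (rule ccontr)
      assume "?b \<noteq> 0"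
      \<comment> \<open>With \<open>?a = 0\<close> the form is linear in \<open>s\<close>; the
        chosen \<open>s\<close> gives it the value \<open>- ?c - 2\<close>, which is
        negative.\<close>
      then show False
        using q[of "- (?c + 1) / ?b" 1] True l2_inner_self_nonneg[of g] by simp
    qed
    then show ?thesis by simp
  next
    case False
    then have "?a > 0" using l2_inner_self_nonneg[of f] by linarith
    have "0 \<le> ?a * (?a * ?c - ?b\<^sup>2)"
      using q[of "- ?b" ?a] by (simp add: power2_eq_square algebra_simps)
    then show ?thesis using \<open>?a > 0\<close> by (simp add: zero_le_mult_iff)
  qed
  then have "sqrt (?b\<^sup>2) \<le> sqrt (?a * ?c)" by (rule real_sqrt_le_mono)
  then show ?thesis by (simp add: l2_norm_def real_sqrt_mult)
qed

lemma l2_norm_triangle: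
  assumes "f \<in> L2" "g \<in> L2"
  shows "l2_norm (f + g) \<le> l2_norm f + l2_norm g"
proof (rule power2_le_imp_le)
  have "(l2_norm (f + g))\<^sup>2 = (l2_norm f)\<^sup>2 + 2 * l2_inner f g + (l2_norm g)\<^sup>2"
    using assms by (simp add: l2_norm_square l2_inner_add_left l2_inner_add_right L2_add l2_inner_commute[of g f])
  also have "\<dots> \<le> (l2_norm f + l2_norm g)\<^sup>2"
    using l2_Cauchy_Schwarz[OF assms] by (simp add: power2_sum)
  finally show "(l2_norm (f + g))\<^sup>2 \<le> (l2_norm f + l2_norm g)\<^sup>2" .
qed simp

lemma l2_norm_triangle_diff:
  assumes "f \<in> L2" "g \<in> L2" "h \<in> L2"
  shows "l2_norm (f - h) \<le> l2_norm (f - g) + l2_norm (g - h)"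
  using l2_norm_triangle[of "f - g" "g - h"] assms by (simp add: L2_diff)

lemma l2_norm_eq_0_iff_AE:
  assumes "f \<in> L2"
  shows "l2_norm f = 0 \<longleftrightarrow> (AE x in lborel. f x = 0)"
  using integral_nonneg_eq_0_iff_AE[OF L2_integrable_mult[OF assms assms]]
  by (simp add: l2_norm_def l2_inner_def)

lemma l2_inner_cong_AE:
  assumes "f \<in> L2" "f' \<in> L2" "g \<in> L2" "g' \<in> L2"
    and "AE x in lborel. f x = f' x" "AE x in lborel. g x = g' x"
  shows "l2_inner f g = l2_inner f' g'"
  unfolding l2_inner_def
  by (rule integral_cong_AE) (use assms(5,6) assms(1-4)[THEN L2_measurable] in auto)

text \<open>The set where \<open>f\<close> differs from 0 is open, and a nonempty open set is not
  null. This later turns nonvanishing at a single point into positivity of the norm.\<close>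

lemma AE_lborel_continuous_zero:
  fixes f :: "real \<Rightarrow> real"
  assumes "continuous_on UNIV f" "AE x in lborel. f x = 0"
  shows "f x = 0"
proof (rule ccontr)
  assume "f x \<noteq> 0"
  have "open {x. f x \<noteq> 0}"
    using assms(1) by (intro open_Collect_neq continuous_intros)
  moreover have "{x. f x \<noteq> 0} \<in> null_sets lborel"
    using assms(2) \<open>open _\<close> by (subst AE_iff_null_sets) auto
  then have "negligible {x. f x \<noteq> 0}"
    by (simp add: negligible_iff_null_sets null_sets_completionI)
  ultimately show False using open_not_negligible \<open>f x \<noteq> 0\<close> by blast
qed

lemma l2_norm_continuous_pos:
  assumes "f \<in> L2" "continuous_on UNIV f" "f x \<noteq> 0"
  shows "l2_norm f > 0"
proof -
  have "l2_norm f \<noteq> 0"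
    using AE_lborel_continuous_zero[OF assms(2)] l2_norm_eq_0_iff_AE[OF assms(1)] assms(3) by blast
  then show ?thesis using l2_norm_nonneg[of f] by linarith
qed

section \<open>Closed subspaces\<close>

lemma l2_closure_subset_L2: "l2_closure S \<subseteq> L2"
  by (auto simp: l2_closure_def)

lemma l2_closure_mono: "S \<subseteq> T \<Longrightarrow> l2_closure S \<subseteq> l2_closure T"
  by (fastforce simp: l2_closure_def)

lemma l2_closure_superset: "S \<subseteq> L2 \<Longrightarrow> S \<subseteq> l2_closure S"
  by (auto simp: l2_closure_def intro!: bexI[of _ "_ :: real \<Rightarrow> real"])

lemma l2_closure_idem: "l2_closure (l2_closure S) = l2_closure S"
proof
  show "l2_closure (l2_closure S) \<subseteq> l2_closure S"
  proof
    fix f assume f: "f \<in> l2_closure (l2_closure S)"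
    have "\<exists>h\<in>S \<inter> L2. l2_norm (f - h) < e" if "e > 0" for e
    proof -
      obtain g where g: "g \<in> l2_closure S" "l2_norm (f - g) < e/2"
        using f \<open>e > 0\<close> unfolding l2_closure_def by (smt (verit) IntD1 half_gt_zero mem_Collect_eq)
      then obtain h where h: "h \<in> S \<inter> L2" "l2_norm (g - h) < e/2"
        using \<open>e > 0\<close> unfolding l2_closure_def by (smt (verit) half_gt_zero mem_Collect_eq)
      have "l2_norm (f - h) \<le> l2_norm (f - g) + l2_norm (g - h)"
        using f g h l2_closure_subset_L2 by (intro l2_norm_triangle_diff) auto
      then show ?thesis using g h by (intro bexI[of _ h]) auto
    qed
    then show "f \<in> l2_closure S" using f by (auto simp: l2_closure_def)
  qed
qed (rule l2_closure_superset[OF l2_closure_subset_L2])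

lemma subspace_l2_closure:
  assumes "subspace S"
  shows "subspace (l2_closure S)"
proof (rule subspaceI)
  show "0 \<in> l2_closure S"
    using assms by (auto simp: l2_closure_def subspace_0 intro!: bexI[of _ 0])
next
  fix f g assume f: "f \<in> l2_closure S" and g: "g \<in> l2_closure S"
  have "\<exists>h\<in>S \<inter> L2. l2_norm (f + g - h) < e" if "e > 0" for e
  proof -
    obtain f' where f': "f' \<in> S \<inter> L2" "l2_norm (f - f') < e/2"
      using f \<open>e > 0\<close> unfolding l2_closure_def by (smt (verit) half_gt_zero mem_Collect_eq)
    obtain g' where g': "g' \<in> S \<inter> L2" "l2_norm (g - g') < e/2"
      using g \<open>e > 0\<close> unfolding l2_closure_def by (smt (verit) half_gt_zero mem_Collect_eq)
    have "l2_norm ((f - f') + (g - g')) \<le> l2_norm (f - f') + l2_norm (g - g')"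
      using f g f' g' l2_closure_subset_L2 by (intro l2_norm_triangle) auto
    then have "l2_norm (f + g - (f' + g')) < e" using f' g' by (simp add: algebra_simps)
    then show ?thesis using f' g' assms by (intro bexI[of _ "f' + g'"]) (auto simp: subspace_add)
  qed
  then show "f + g \<in> l2_closure S" using f g by (auto simp: l2_closure_def)
next
  fix c f assume f: "f \<in> l2_closure S"
  have "\<exists>h\<in>S \<inter> L2. l2_norm (c *\<^sub>R f - h) < e" if "e > 0" for e
  proof -
    \<comment> \<open>The added 1 covers \<open>c = 0\<close>.\<close>
    have "e / (\<bar>c\<bar> + 1) > 0" using \<open>e > 0\<close> by (simp add: field_simps)
    then obtain f' where f': "f' \<in> S \<inter> L2" "l2_norm (f - f') < e / (\<bar>c\<bar> + 1)"
      using f unfolding l2_closure_def by blast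
    have "l2_norm (c *\<^sub>R f - c *\<^sub>R f') = \<bar>c\<bar> * l2_norm (f - f')"
      by (simp add: l2_norm_scaleR flip: scaleR_diff_right)
    also have "\<dots> \<le> (\<bar>c\<bar> + 1) * l2_norm (f - f')" by (simp add: algebra_simps)
    also have "\<dots> < e" using f'(2) by (simp add: field_simps)
    finally show ?thesis using f' assms by (intro bexI[of _ "c *\<^sub>R f'"]) (auto simp: subspace_scale)
  qed
  then show "c *\<^sub>R f \<in> l2_closure S" using f by (auto simp: l2_closure_def)
qed

lemma closed_l2_subspace_closure_span: "closed_l2_subspace (l2_closure (span S))"
  by (simp add: closed_l2_subspace_def subspace_l2_closure l2_closure_idem)

lemma l2_closure_sequentialI:
  assumes "f \<in> L2" "\<And>n. s n \<in> S" "\<And>n. s n \<in> L2" "(\<lambda>n. l2_norm (f - s n)) \<longlonglongrightarrow> 0"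
  shows "f \<in> l2_closure S"
proof -
  have "\<exists>g\<in>S \<inter> L2. l2_norm (f - g) < e" if "e > 0" for e
  proof -
    from order_tendstoD(2)[OF assms(4) that] obtain n where "l2_norm (f - s n) < e"
      by (auto simp: eventually_sequentially)
    then show ?thesis using assms(2,3) by blast
  qed
  then show ?thesis using assms(1) by (simp add: l2_closure_def)
qed

text \<open>Dominated convergence for the squared differences, with the square of \<open>h\<close>
  as majorant; therefore \<open>h\<close> bounds the difference and not \<open>s n\<close>
  itself.\<close>

lemma l2_norm_dominated_tendsto_0:
  assumes s: "\<And>n. s n \<in> L2" and f: "f \<in> L2" and h: "h \<in> L2"
    and lim: "AE x in lborel. (\<lambda>n. s n x) \<longlonglongrightarrow> f x"
    and bound: "\<And>n. AE x in lborel. \<bar>s n x - f x\<bar> \<le> \<bar>h x\<bar>"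
  shows "(\<lambda>n. l2_norm (f - s n)) \<longlonglongrightarrow> 0"
proof -
  have "(\<lambda>n. LINT x|lborel. (s n x - f x)\<^sup>2) \<longlonglongrightarrow> (LINT x::real|lborel. (0::real))"
  proof (rule integral_dominated_convergence[where s = "\<lambda>n x. (s n x - f x)\<^sup>2" and f = "\<lambda>x. 0" and w = "\<lambda>x. (h x)\<^sup>2"])
    show "(\<lambda>x. (s n x - f x)\<^sup>2) \<in> borel_measurable lborel" for n
      using L2_measurable[OF s[of n]] L2_measurable[OF f] by simp
    show "AE x in lborel. (\<lambda>n. (s n x - f x)\<^sup>2) \<longlonglongrightarrow> 0"
      using lim
    proof eventually_elim
      case (elim x)
      then have "(\<lambda>n. (s n x - f x)\<^sup>2) \<longlonglongrightarrow> (f x - f x)\<^sup>2" by (intro tendsto_intros)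
      then show ?case by simp
    qed
    show "AE x in lborel. norm ((s n x - f x)\<^sup>2) \<le> (h x)\<^sup>2" for n
      using bound[of n] by eventually_elim (simp add: abs_le_square_iff)
  qed (use h in \<open>auto simp: L2_def\<close>)
  then have "(\<lambda>n. sqrt (LINT x|lborel. (s n x - f x)\<^sup>2)) \<longlonglongrightarrow> sqrt 0"
    by (intro tendsto_real_sqrt) simp
  moreover have "sqrt (LINT x|lborel. (s n x - f x)\<^sup>2) = l2_norm (f - s n)" for n
    by (subst l2_norm_minus_commute) (simp add: l2_norm_def l2_inner_def power2_eq_square)
  ultimately show ?thesis by simp
qed

section \<open>Totality of the indicators of intervals in the space of square integrable
  functions\<close>

lemma indicator_bounded_L2:
  assumes "A \<in> sets borel" "emeasure lborel A < \<infinity>"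
  shows "(indicator A :: real \<Rightarrow> real) \<in> L2"
proof -
  have "(\<lambda>x. (indicator A x :: real)\<^sup>2) = indicator A"
    by (auto simp: fun_eq_iff indicator_def)
  then show ?thesis using assms by (simp add: L2_def)
qed

lemma indicator_Icc_L2: "(indicator {a..b} :: real \<Rightarrow> real) \<in> L2"
  using emeasure_bounded_finite[of "{a..b}"] by (intro indicator_bounded_L2) auto

text \<open>The indicators of the traces of Borel sets on a bounded interval form a Dynkin class, so the
  intervals suffice.\<close>

lemma indicator_in_closed_subspace:
  assumes D: "closed_l2_subspace D" and Icc: "\<And>a b. a \<le> b \<Longrightarrow> indicator {a..b} \<in> D"
    and A: "A \<in> sets borel"
  shows "(indicator (A \<inter> {-N..N}) :: real \<Rightarrow> real) \<in> D"
proof -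
  have sub: "subspace D" and clo: "l2_closure D = D" using D by (auto simp: closed_l2_subspace_def)
  have "(indicator {} :: real \<Rightarrow> real) = 0"
    by (simp add: fun_eq_iff)
  then have z: "(indicator {} :: real \<Rightarrow> real) \<in> D"
    using subspace_0[OF sub] by simp
  \<comment> \<open>Empty intervals are included, since the trace of an interval on
    \<open>{-N..N}\<close> may be empty.\<close>
  have Icc': "indicator {a..b} \<in> D" for a b
    using Icc[of a b] z by (cases "a \<le> b") auto
  show ?thesis using A
  proof (induction rule: borel_set_induct)
    case empty
    show ?case using subspace_0[OF sub] by (simp add: zero_fun_def)
  next
    case (interval a b)
    show ?case using Icc' by simp
  next
    case (compl A)
    have "(indicator (- A \<inter> {-N..N}) :: real \<Rightarrow> real) = indicator {-N..N} - indicator (A \<inter> {-N..N})"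
      by (auto simp: fun_eq_iff indicator_def)
    then show ?case using subspace_diff[OF sub Icc' compl.IH] by (simp only:)
  next
    case (union F)
    let ?s = "\<lambda>n. \<Sum>i<n. indicator (F i \<inter> {-N..N}) :: real \<Rightarrow> real"
    have F: "emeasure lborel (B \<inter> {-N..N}) < \<infinity>" if "B \<in> sets borel" for B
      using emeasure_bounded_finite[of "B \<inter> {-N..N}"] by (simp add: bounded_Int)
    have FL: "(indicator (B \<inter> {-N..N}) :: real \<Rightarrow> real) \<in> L2" if "B \<in> sets borel" for B
      using F[OF that] that by (intro indicator_bounded_L2) auto
    \<comment> \<open>Disjointness makes the partial sums indicators of finite unions, so the
      indicator of the full trace dominates their distance to it.\<close>
    have s_eq: "?s n = indicator ((\<Union>i<n. F i) \<inter> {-N..N})" for n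
    proof (induction n)
      case (Suc n)
      have disj: "F n \<inter> F i = {}" if "i < n" for i
        using disjoint_family_onD[OF union(1), of n i] that by simp
      show ?case
      proof
        fix x
        have "(\<Sum>i<Suc n. indicator (F i \<inter> {-N..N})) x
          = indicator ((\<Union>i<n. F i) \<inter> {-N..N}) x + (indicator (F n \<inter> {-N..N}) x :: real)"
          by (simp only: sum.lessThan_Suc Suc plus_fun_apply)
        also have "\<dots> = indicator ((\<Union>i<Suc n. F i) \<inter> {-N..N}) x"
          using disj by (fastforce simp: indicator_def less_Suc_eq)
        finally show "(\<Sum>i<Suc n. indicator (F i \<inter> {-N..N})) x
          = (indicator ((\<Union>i<Suc n. F i) \<inter> {-N..N}) x :: real)" .
      qed
    qed (simp add: zero_fun_def)
    have "indicator ((\<Union>i. F i) \<inter> {-N..N}) \<in> l2_closure D"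
    proof (rule l2_closure_sequentialI)
      show L: "(indicator ((\<Union>i. F i) \<inter> {-N..N}) :: real \<Rightarrow> real) \<in> L2"
        using union(2) by (intro FL) auto
      show "?s n \<in> D" for n using union(3) by (intro subspace_sum[OF sub])
      show sL: "?s n \<in> L2" for n unfolding s_eq using union(2) by (intro FL) auto
      show "(\<lambda>n. l2_norm (indicator ((\<Union>i. F i) \<inter> {-N..N}) - ?s n)) \<longlonglongrightarrow> 0"
      proof (rule l2_norm_dominated_tendsto_0[OF sL L L])
        have "(\<lambda>n. indicator ((\<Union>i<n. F i) \<inter> {-N..N}) x) \<longlonglongrightarrow> (indicator ((\<Union>i. F i) \<inter> {-N..N}) x :: real)" for x :: real
        proof (cases "\<exists>i. x \<in> F i")
          case True
          then obtain i where "x \<in> F i" by blast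
          then have "eventually (\<lambda>n. indicator ((\<Union>i<n. F i) \<inter> {-N..N}) x
               = (indicator ((\<Union>i. F i) \<inter> {-N..N}) x :: real)) sequentially"
            by (intro eventually_sequentiallyI[of "Suc i"]) (auto simp: indicator_def Suc_le_eq)
          then show ?thesis by (rule tendsto_eventually)
        qed (auto simp: indicator_def)
        then show "AE x in lborel. (\<lambda>n. ?s n x) \<longlonglongrightarrow> indicator ((\<Union>i. F i) \<inter> {-N..N}) x"
          unfolding s_eq by simp
        show "AE x in lborel. \<bar>?s n x - indicator ((\<Union>i. F i) \<inter> {-N..N}) x\<bar>
                \<le> \<bar>indicator ((\<Union>i. F i) \<inter> {-N..N}) x\<bar>" for n
          unfolding s_eq by (auto simp: indicator_def)
      qed
    qed
    then show ?case using clo by simp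
  qed
qed

text \<open>Simple functions converging to \<open>f\<close> pointwise, cut off to
  \<open>[-n, n]\<close>, are finite combinations of the indicators just shown to lie in
  \<open>D\<close>.\<close>

lemma closed_l2_subspace_eq_L2:
  assumes D: "closed_l2_subspace D" and Icc: "\<And>a b. a \<le> b \<Longrightarrow> indicator {a..b} \<in> D"
  shows "D = L2"
proof
  have sub: "subspace D" and clo: "l2_closure D = D" using D by (auto simp: closed_l2_subspace_def)
  show "D \<subseteq> L2" using clo l2_closure_subset_L2 by blast
  show "L2 \<subseteq> D"
  proof
    fix f assume f: "f \<in> L2"
    have "f \<in> borel_measurable lborel" using L2_measurable[OF f] by simp
    from borel_measurable_implies_sequence_metric[OF this, of 0]
    have "\<exists>F. (\<forall>i. simple_function lborel (F i)) \<and> (\<forall>x. (\<lambda>i. F i x) \<longlonglongrightarrow> f x) \<and>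
        (\<forall>i x. dist (F i x) 0 \<le> 2 * dist (f x) 0)"
      by simp
    then obtain F where "\<forall>i. simple_function lborel (F i)" "\<forall>x. (\<lambda>i. F i x) \<longlonglongrightarrow> f x"
       "\<forall>i x. dist (F i x) 0 \<le> 2 * dist (f x) 0"
      by (elim exE conjE)
    then have F: "\<And>i. simple_function lborel (F i)" "\<And>x. (\<lambda>i. F i x) \<longlonglongrightarrow> f x"
       "\<And>i x. dist (F i x) 0 \<le> 2 * dist (f x) 0"
      by blast+
    define s where "s n = (\<lambda>x. F n x * indicator {- real n..real n} x)" for n
    have s_eq: "s n = (\<Sum>y\<in>range (F n). y *\<^sub>R indicator (F n -` {y} \<inter> {- real n..real n}))" for n
    proof
      fix x
      have "(\<Sum>y\<in>range (F n). y *\<^sub>R indicator (F n -` {y} \<inter> {- real n..real n})) x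
         = (\<Sum>y\<in>range (F n). if y = F n x then F n x * indicator {- real n..real n} x else 0)"
        by (subst sum_fun_apply) (auto intro!: sum.cong simp: indicator_def)
      also have "\<dots> = s n x"
        using simple_functionD(1)[OF F(1)[of n]] by (simp add: s_def)
      finally show "s n x = (\<Sum>y\<in>range (F n). y *\<^sub>R indicator (F n -` {y} \<inter> {- real n..real n})) x" by simp
    qed
    have sD: "s n \<in> D" for n
      unfolding s_eq
    proof (intro subspace_sum[OF sub] subspace_scale[OF sub] indicator_in_closed_subspace[OF D Icc])
      show "F n -` {y} \<in> sets borel" for y
        using simple_functionD(2)[OF F(1)[of n], of "{y}"] by simp
    qed
    have sL: "s n \<in> L2" for n using sD \<open>D \<subseteq> L2\<close> by blast
    have "f \<in> l2_closure D"
    proof (rule l2_closure_sequentialI[OF f sD sL])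
      show "(\<lambda>n. l2_norm (f - s n)) \<longlonglongrightarrow> 0"
      proof (rule l2_norm_dominated_tendsto_0[OF sL f, where h = "3 *\<^sub>R f"])
        show "3 *\<^sub>R f \<in> L2" using f by auto
        have "(\<lambda>n. s n x) \<longlonglongrightarrow> f x" for x
        proof (rule Lim_transform_eventually[OF F(2)[of x]])
          obtain n0 where "\<bar>x\<bar> \<le> real n0" using real_arch_simple by blast
          then show "eventually (\<lambda>n. F n x = s n x) sequentially"
            by (intro eventually_sequentiallyI[of n0]) (auto simp: s_def indicator_def)
        qed
        then show "AE x in lborel. (\<lambda>n. s n x) \<longlonglongrightarrow> f x" by simp
        \<comment> \<open>The approximants are bounded by twice \<open>\<bar>f x\<bar>\<close>, and
          subtracting \<open>f x\<close> adds one more, hence the factor 3.\<close>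
        have "\<bar>s n x - f x\<bar> \<le> \<bar>(3 *\<^sub>R f) x\<bar>" for n x
          using F(3)[of n x] by (auto simp: s_def indicator_def abs_mult dist_real_def)
        then show "AE x in lborel. \<bar>s n x - f x\<bar> \<le> \<bar>(3 *\<^sub>R f) x\<bar>" for n by simp
      qed
    qed
    then show "f \<in> D" using clo by simp
  qed
qed

text \<open>By Parseval for finite sums both Riesz bounds hold with constant 1.\<close>

lemma orthonormal_basis_imp_riesz_basis:
  assumes "orthonormal_basis_of H I b"
  shows "riesz_basis_of H I b"
proof -
  have L: "\<And>i. i \<in> I \<Longrightarrow> b i \<in> L2"
    and orth: "\<And>i j. i \<in> I \<Longrightarrow> j \<in> I \<Longrightarrow> l2_inner (b i) (b j) = (if i = j then 1 else 0)"
    using assms by (auto simp: orthonormal_basis_of_def orthonormal_system_def)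
  have "(l2_norm (\<Sum>i\<in>F. c i *\<^sub>R b i))\<^sup>2 = (\<Sum>i\<in>F. (c i)\<^sup>2)" if F: "finite F" "F \<subseteq> I" for F c
  proof -
    have "(l2_norm (\<Sum>i\<in>F. c i *\<^sub>R b i))\<^sup>2 = (\<Sum>i\<in>F. \<Sum>j\<in>F. c i * (c j * l2_inner (b i) (b j)))"
      unfolding l2_norm_square using F(2) L
      by (subst l2_inner_sum_left, force, blast)
        (intro sum.cong refl, subst l2_inner_sum_right, force, force, simp add: sum_distrib_left mult.left_commute)
    also have "\<dots> = (\<Sum>i\<in>F. \<Sum>j\<in>F. if j = i then (c i)\<^sup>2 else 0)"
      using F(2) orth by (intro sum.cong refl) (auto simp: subset_iff power2_eq_square)
    also have "\<dots> = (\<Sum>i\<in>F. (c i)\<^sup>2)" using F(1) by simp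
    finally show ?thesis .
  qed
  then have "\<exists>A>0. \<exists>B>0. \<forall>F c. finite F \<and> F \<subseteq> I \<longrightarrow>
        A * (\<Sum>i\<in>F. (c i)\<^sup>2) \<le> (l2_norm (\<Sum>i\<in>F. c i *\<^sub>R b i))\<^sup>2 \<and>
        (l2_norm (\<Sum>i\<in>F. c i *\<^sub>R b i))\<^sup>2 \<le> B * (\<Sum>i\<in>F. (c i)\<^sup>2)"
    by (intro exI[of _ 1] conjI allI impI) simp_all
  then show ?thesis
    using assms by (simp add: riesz_basis_of_def orthonormal_basis_of_def orthonormal_system_def)
qed

section \<open>Dilations and translations\<close>

text \<open>The factor makes dilation an isometry and matches the normalisation in \<open>xi\<close>
  and \<open>scaling_fun\<close>. The dilation in \<open>mra\<close> is not normalised;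
  \<open>scaling_space_dil_iff\<close> reconciles the two.\<close>

definition dil :: "int \<Rightarrow> (real \<Rightarrow> real) \<Rightarrow> real \<Rightarrow> real" where
  "dil j f x = 2 powr (of_int j / 2) * f (2 powi j * x)"

definition translate :: "int \<Rightarrow> (real \<Rightarrow> real) \<Rightarrow> real \<Rightarrow> real" where
  "translate k f x = f (x - of_int k)"

lemma linear_dil: "linear (dil j)"
  by (rule linearI) (simp_all add: fun_eq_iff dil_def algebra_simps)

lemma linear_translate: "linear (translate k)"
  by (rule linearI) (simp_all add: fun_eq_iff translate_def)

lemma dil_dil: "dil i (dil j f) = dil (i + j) f"
  by (simp add: fun_eq_iff dil_def power_int_add powr_add add_divide_distrib mult_ac)

lemma dil_0 [simp]: "dil 0 f = f"
  by (simp add: fun_eq_iff dil_def)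

lemma translate_translate: "translate i (translate j f) = translate (i + j) f"
  by (simp add: fun_eq_iff translate_def algebra_simps)

lemma translate_0 [simp]: "translate 0 f = f"
  by (simp add: fun_eq_iff translate_def)

lemma L2_affine:
  assumes "f \<in> L2" "a \<noteq> 0"
  shows "(\<lambda>x. f (b + a * x)) \<in> L2"
proof -
  have "integrable lborel (\<lambda>x. (f (b + a * x))\<^sup>2)"
    using lborel_integrable_real_affine[OF L2_integrable_square[OF assms(1)] assms(2)] .
  then show ?thesis using L2_measurable[OF assms(1)] by (simp add: L2_def)
qed

lemma dil_L2:
  assumes "f \<in> L2"
  shows "dil j f \<in> L2"
proof -
  have "dil j f = (2 powr (of_int j / 2)) *\<^sub>R (\<lambda>x. f (0 + 2 powi j * x))"
    by (simp add: fun_eq_iff dil_def)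
  then show ?thesis using L2_affine[OF assms, of "2 powi j" 0] by auto
qed

lemma translate_L2:
  assumes "f \<in> L2"
  shows "translate k f \<in> L2"
proof -
  have "translate k f = (\<lambda>x. f (- of_int k + 1 * x))"
    by (simp add: fun_eq_iff translate_def algebra_simps)
  then show ?thesis using L2_affine[OF assms, of 1 "- of_int k"] by simp
qed

lemma l2_inner_dil: "l2_inner (dil j f) (dil j g) = l2_inner f g"
proof -
  have sq: "2 powr (of_int j / 2) * 2 powr (of_int j / 2) = (2 powi j :: real)"
    by (simp add: powr_real_of_int' flip: powr_add)
  have "l2_inner f g = \<bar>2 powi j\<bar> * (LINT x|lborel. f (0 + 2 powi j * x) * g (0 + 2 powi j * x))"
    unfolding l2_inner_def
    using lborel_integral_real_affine[of "2 powi j" "\<lambda>x. f x * g x" 0] by simp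
  also have "\<dots> = (LINT x|lborel. 2 powi j * (f (2 powi j * x) * g (2 powi j * x)))"
    by simp
  also have "\<dots> = l2_inner (dil j f) (dil j g)"
    unfolding l2_inner_def dil_def sq[symmetric] by (simp add: mult_ac)
  finally show ?thesis ..
qed

lemma l2_inner_translate: "l2_inner (translate k f) (translate k g) = l2_inner f g"
  unfolding l2_inner_def
  using lborel_integral_real_affine[of 1 "\<lambda>x. f x * g x" "- of_int k"]
  by (simp add: translate_def algebra_simps)

lemma l2_norm_dil [simp]: "l2_norm (dil j f) = l2_norm f"
  by (simp add: l2_norm_def l2_inner_dil)

lemma l2_norm_translate [simp]: "l2_norm (translate k f) = l2_norm f"
  by (simp add: l2_norm_def l2_inner_translate)

lemma l2_closure_dil_subset: "dil j ` l2_closure S \<subseteq> l2_closure (dil j ` S)"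
proof (rule image_subsetI)
  fix f assume f: "f \<in> l2_closure S"
  have "\<exists>h\<in>dil j ` S \<inter> L2. l2_norm (dil j f - h) < e" if e: "e > 0" for e
  proof -
    obtain g where g: "g \<in> S \<inter> L2" "l2_norm (f - g) < e"
      using f e unfolding l2_closure_def by blast
    have "dil j f - dil j g = dil j (f - g)" using linear_diff[OF linear_dil] by metis
    then show ?thesis using g dil_L2 by (intro bexI[of _ "dil j g"]) auto
  qed
  then show "dil j f \<in> l2_closure (dil j ` S)"
    using f dil_L2 by (auto simp: l2_closure_def)
qed

text \<open>The missing inclusion is the preceding one for the inverse \<open>dil (- j)\<close>,
  transported back by \<open>dil j\<close>.\<close>

lemma l2_closure_dil: "l2_closure (dil j ` S) = dil j ` l2_closure S"
proof
  have "dil (- j) ` l2_closure (dil j ` S) \<subseteq> l2_closure S"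
    using l2_closure_dil_subset[of "- j" "dil j ` S"] by (simp add: image_image dil_dil)
  then have "dil j ` dil (- j) ` l2_closure (dil j ` S) \<subseteq> dil j ` l2_closure S" by blast
  then show "l2_closure (dil j ` S) \<subseteq> dil j ` l2_closure S"
    by (simp add: image_image dil_dil)
qed (rule l2_closure_dil_subset)

lemma l2_closure_span_dil: "l2_closure (span (dil j ` S)) = dil j ` l2_closure (span S)"
  by (simp add: linear_span_image[OF linear_dil] l2_closure_dil)

section \<open>Functions vanishing outside an interval\<close>

definition supported :: "real \<Rightarrow> real \<Rightarrow> (real \<Rightarrow> real) set" where
  "supported a b = {f. \<forall>x. x \<notin> {a..b} \<longrightarrow> f x = 0}"

lemma supportedD: "f \<in> supported a b \<Longrightarrow> x < a \<or> b < x \<Longrightarrow> f x = 0"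
  by (auto simp: supported_def)

lemma subspace_supported: "subspace (supported a b)"
  by (rule subspaceI) (auto simp: supported_def)

lemma supported_mono: "f \<in> supported a b \<Longrightarrow> c \<le> a \<Longrightarrow> b \<le> d \<Longrightarrow> f \<in> supported c d"
  by (auto simp: supported_def)

lemma supported_translate: "f \<in> supported a b \<Longrightarrow> translate k f \<in> supported (a + of_int k) (b + of_int k)"
  by (auto simp: supported_def translate_def)

lemma continuous_restrict_L2:
  fixes f :: "real \<Rightarrow> real"
  assumes "continuous_on UNIV f"
  shows "(\<lambda>x. f x * indicator {a..b} x) \<in> L2"
proof -
  have "continuous_on {a..b} (\<lambda>x. (f x)\<^sup>2)"
    using assms by (intro continuous_intros) (rule continuous_on_subset, auto)
  from borel_integrable_compact[OF _ this]
  have "integrable lborel (\<lambda>x. indicator {a..b} x *\<^sub>R (f x)\<^sup>2)" by simp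
  moreover have "(\<lambda>x. indicator {a..b} x *\<^sub>R (f x)\<^sup>2) = (\<lambda>x. (f x * indicator {a..b} x)\<^sup>2)"
    by (auto simp: fun_eq_iff indicator_def)
  ultimately have "integrable lborel (\<lambda>x. (f x * indicator {a..b} x)\<^sup>2)" by simp
  moreover have "f \<in> borel_measurable borel"
    using assms by (rule borel_measurable_continuous_onI)
  ultimately show ?thesis by (simp add: L2_def)
qed

lemma continuous_supported_L2:
  fixes f :: "real \<Rightarrow> real"
  assumes "continuous_on UNIV f" "f \<in> supported a b"
  shows "f \<in> L2"
proof -
  have "f = (\<lambda>x. f x * indicator {a..b} x)"
    using assms(2) by (auto simp: fun_eq_iff supported_def indicator_def)
  then show ?thesis using continuous_restrict_L2[OF assms(1), of a b] by simp
qed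

lemma continuous_supported_bounded:
  fixes f :: "real \<Rightarrow> real"
  assumes "continuous_on UNIV f" "f \<in> supported a b"
  obtains M where "\<And>x. \<bar>f x\<bar> \<le> M"
proof -
  have "compact (f ` {a..b})"
    using assms(1) by (intro compact_continuous_image) (auto intro: continuous_on_subset)
  then have "bounded (f ` {a..b})" by (rule compact_imp_bounded)
  then obtain M where M: "\<And>x. x \<in> {a..b} \<Longrightarrow> \<bar>f x\<bar> \<le> M"
    unfolding bounded_iff by (metis imageI real_norm_def)
  have "\<bar>f x\<bar> \<le> max M 0" for x
    using M[of x] assms(2) by (cases "x \<in> {a..b}") (auto simp: supported_def)
  then show ?thesis by (rule that)
qed

text \<open>If \<open>b = c\<close> the supports may still share that one point, which is a null
  set.\<close>

lemma l2_inner_essentially_disjoint: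
  assumes "f \<in> supported a b" "g \<in> supported c d" "b \<le> c"
  shows "l2_inner f g = 0" "l2_inner g f = 0"
proof -
  have "AE x in lborel. x \<noteq> b" by (rule AE_lborel_singleton)
  then have "AE x in lborel. f x * g x = 0"
  proof eventually_elim
    case (elim x)
    then show ?case using assms by (cases "x < b") (auto simp: supported_def)
  qed
  then show "l2_inner f g = 0"
    unfolding l2_inner_def by (simp add: integral_eq_zero_AE)
  then show "l2_inner g f = 0" by (simp add: l2_inner_commute)
qed

lemma l2_inner_translates_unit:
  assumes "f \<in> supported 0 1" "g \<in> supported 0 1"
  shows "l2_inner (translate m f) (translate n g) = (if m = n then l2_inner f g else 0)"
proof (cases m n rule: linorder_cases)
  case less
  then have "of_int m + 1 \<le> (of_int n :: real)" by linarith
  then show ?thesis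
    using less l2_inner_essentially_disjoint[OF supported_translate[OF assms(1), of m] supported_translate[OF assms(2), of n]]
    by simp
next
  case greater
  then have "of_int n + 1 \<le> (of_int m :: real)" by linarith
  then show ?thesis
    using greater l2_inner_essentially_disjoint[OF supported_translate[OF assms(2), of n] supported_translate[OF assms(1), of m]]
    by simp
qed (simp add: l2_inner_translate)

section \<open>Continuously differentiable cubic splines\<close>

text \<open>As a subspace invariant under dilations and translations, this set reduces the
  regularity of all generators to that of \<open>xi1\<close> and \<open>xi2\<close>.\<close>

definition c1_splines :: "(real \<Rightarrow> real) set" where
  "c1_splines = {f. cubic_spline f \<and> f C1_differentiable_on UNIV}"

lemma cubic_spline_zero: "cubic_spline 0"
  unfolding cubic_spline_def by (intro exI[of _ "{}"]) (auto intro!: exI[of _ 0])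

lemma cubic_spline_add:
  assumes "cubic_spline f" "cubic_spline g"
  shows "cubic_spline (f + g)"
proof -
  obtain K where K: "finite K" "\<And>a b. a < b \<Longrightarrow> {a<..<b} \<inter> K = {} \<Longrightarrow>
       \<exists>q :: real poly. degree q \<le> 3 \<and> (\<forall>x\<in>{a..b}. f x = poly q x)"
    using assms(1) unfolding cubic_spline_def by blast
  obtain L where L: "finite L" "\<And>a b. a < b \<Longrightarrow> {a<..<b} \<inter> L = {} \<Longrightarrow>
       \<exists>q :: real poly. degree q \<le> 3 \<and> (\<forall>x\<in>{a..b}. g x = poly q x)"
    using assms(2) unfolding cubic_spline_def by blast
  show ?thesis unfolding cubic_spline_def
  proof (intro exI[of _ "K \<union> L"] conjI allI impI)
    fix a b :: real assume ab: "a < b \<and> {a<..<b} \<inter> (K \<union> L) = {}"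
    obtain q where "degree q \<le> 3" "\<forall>x\<in>{a..b}. f x = poly q x" using K(2)[of a b] ab by blast
    moreover obtain r where "degree r \<le> 3" "\<forall>x\<in>{a..b}. g x = poly r x" using L(2)[of a b] ab by blast
    ultimately show "\<exists>q. degree q \<le> 3 \<and> (\<forall>x\<in>{a..b}. (f + g) x = poly q x)"
      by (intro exI[of _ "q + r"]) (auto intro: degree_add_le)
  qed (use K(1) L(1) in auto)
qed

lemma cubic_spline_scaleR:
  assumes "cubic_spline f"
  shows "cubic_spline (c *\<^sub>R f)"
proof -
  obtain K where K: "finite K" "\<And>a b. a < b \<Longrightarrow> {a<..<b} \<inter> K = {} \<Longrightarrow>
       \<exists>q :: real poly. degree q \<le> 3 \<and> (\<forall>x\<in>{a..b}. f x = poly q x)"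
    using assms(1) unfolding cubic_spline_def by blast
  show ?thesis unfolding cubic_spline_def
  proof (intro exI[of _ K] conjI allI impI)
    fix a b :: real assume ab: "a < b \<and> {a<..<b} \<inter> K = {}"
    obtain q where "degree q \<le> 3" "\<forall>x\<in>{a..b}. f x = poly q x" using K(2)[of a b] ab by blast
    then show "\<exists>q. degree q \<le> 3 \<and> (\<forall>x\<in>{a..b}. (c *\<^sub>R f) x = poly q x)"
      by (intro exI[of _ "smult c q"]) (auto intro: order.trans[OF degree_smult_le])
  qed (rule K(1))
qed

lemma cubic_spline_affine:
  assumes "cubic_spline f" "c > 0"
  shows "cubic_spline (\<lambda>x. f (c * x + d))"
proof -
  obtain K where K: "finite K" "\<And>a b. a < b \<Longrightarrow> {a<..<b} \<inter> K = {} \<Longrightarrow>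
       \<exists>q :: real poly. degree q \<le> 3 \<and> (\<forall>x\<in>{a..b}. f x = poly q x)"
    using assms(1) unfolding cubic_spline_def by blast
  show ?thesis unfolding cubic_spline_def
  proof (intro exI[of _ "(\<lambda>k. (k - d) / c) ` K"] conjI allI impI)
    fix a b :: real assume ab: "a < b \<and> {a<..<b} \<inter> (\<lambda>k. (k - d) / c) ` K = {}"
    have "c * a + d < c * b + d" using ab assms(2) by simp
    moreover have "{c * a + d<..<c * b + d} \<inter> K = {}"
    proof (intro equals0I)
      fix k assume "k \<in> {c * a + d<..<c * b + d} \<inter> K"
      then have "(k - d) / c \<in> {a<..<b} \<inter> (\<lambda>k. (k - d) / c) ` K"
        using assms(2) by (auto simp: field_simps)
      then show False using ab by blast
    qed
    ultimately obtain q where q: "degree q \<le> 3" "\<forall>x\<in>{c * a + d..c * b + d}. f x = poly q x"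
      using K(2) by blast
    have "f (c * x + d) = poly (pcompose q [:d, c:]) x" if "x \<in> {a..b}" for x
      using q(2) that assms(2) by (simp add: poly_pcompose mult.commute add.commute)
    moreover have "degree (pcompose q [:d, c:]) \<le> 3"
      using q(1) assms(2) by (simp add: degree_pcompose)
    ultimately show "\<exists>q. degree q \<le> 3 \<and> (\<forall>x\<in>{a..b}. f (c * x + d) = poly q x)"
      by blast
  qed (use K(1) in auto)
qed

lemma subspace_c1_splines: "subspace c1_splines"
proof (rule subspaceI)
  show "0 \<in> c1_splines"
    by (simp add: c1_splines_def cubic_spline_zero) (simp add: zero_fun_def)
  show "f + g \<in> c1_splines" if "f \<in> c1_splines" "g \<in> c1_splines" for f g
    using that by (simp add: c1_splines_def cubic_spline_add) (simp add: plus_fun_def)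
  show "c *\<^sub>R f \<in> c1_splines" if "f \<in> c1_splines" for c f
    using that by (simp add: c1_splines_def cubic_spline_scaleR) (simp add: scaleR_fun_def)
qed

lemma c1_splines_affine:
  assumes "f \<in> c1_splines" "c > 0"
  shows "(\<lambda>x. f (c * x + d)) \<in> c1_splines"
proof -
  have "(f \<circ> (\<lambda>x. c * x + d)) C1_differentiable_on UNIV"
  proof (rule C1_differentiable_compose)
    show "f C1_differentiable_on range (\<lambda>x. c * x + d)"
      using assms(1) by (auto simp: c1_splines_def intro: C1_differentiable_on_subset)
    show "(\<lambda>x. c * x + d) C1_differentiable_on UNIV" by simp
    have "UNIV \<inter> (\<lambda>x. c * x + d) -` {y} \<subseteq> {(y - d) / c}" for y
      using assms(2) by (auto simp: field_simps)
    then show "finite (UNIV \<inter> (\<lambda>x. c * x + d) -` {y})" for y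
      by (rule finite_subset) simp
  qed
  then show ?thesis
    using assms cubic_spline_affine by (simp add: c1_splines_def o_def)
qed

lemma c1_splines_dil:
  assumes "f \<in> c1_splines"
  shows "dil j f \<in> c1_splines"
proof -
  have "dil j f = (2 powr (of_int j / 2)) *\<^sub>R (\<lambda>x. f (2 powi j * x + 0))"
    by (simp add: fun_eq_iff dil_def)
  then show ?thesis
    using subspace_scale[OF subspace_c1_splines c1_splines_affine[OF assms, of "2 powi j" 0]] by simp
qed

lemma c1_splines_translate:
  assumes "f \<in> c1_splines"
  shows "translate k f \<in> c1_splines"
proof -
  have "translate k f = (\<lambda>x. f (1 * x + (- of_int k)))"
    by (simp add: fun_eq_iff translate_def)
  then show ?thesis using c1_splines_affine[OF assms, of 1 "- of_int k"] by simp
qed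

lemma c1_splines_continuous: "f \<in> c1_splines \<Longrightarrow> continuous_on UNIV f"
  by (simp add: c1_splines_def C1_differentiable_imp_continuous_on)

lemma cubic_spline_truncated_power:
  assumes "n \<le> 3" "n > 0"
  shows "cubic_spline (\<lambda>x. max 0 x ^ n)"
  unfolding cubic_spline_def
proof (intro exI[of _ "{0}"] conjI allI impI)
  fix a b :: real assume ab: "a < b \<and> {a<..<b} \<inter> {0} = {}"
  then consider "b \<le> 0" | "0 \<le> a" by fastforce
  then show "\<exists>q. degree q \<le> 3 \<and> (\<forall>x\<in>{a..b}. max 0 x ^ n = poly q x)"
  proof cases
    case 1
    \<comment> \<open>\<open>n > 0\<close> makes the left piece vanish, since
      \<open>0 ^ 0 = 1\<close>.\<close>
    then show ?thesis using assms by (intro exI[of _ 0]) (auto simp: max_def)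
  next
    case 2
    then show ?thesis using assms
      by (intro exI[of _ "monom 1 n"]) (auto simp: max_def poly_monom degree_monom_eq)
  qed
qed simp

lemma DERIV_truncated_square: "((\<lambda>x::real. (max 0 x)\<^sup>2) has_real_derivative 2 * max 0 x) (at x)"
proof (cases x "0::real" rule: linorder_cases)
  case less
  have "((\<lambda>x::real. (max 0 x)\<^sup>2) has_real_derivative 0) (at x)"
    by (rule has_field_derivative_transform_within_open[of "\<lambda>_. 0" 0 x "{..<0}"]) (use less in auto)
  then show ?thesis using less by simp
next
  case greater
  have "((\<lambda>x::real. (max 0 x)\<^sup>2) has_real_derivative 2 * x) (at x)"
    by (rule has_field_derivative_transform_within_open[of "\<lambda>x. x\<^sup>2" _ x "{0<..}"])
      (use greater in \<open>auto intro!: derivative_eq_intros\<close>)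
  then show ?thesis using greater by simp
next
  case equal
  have "((\<lambda>h::real. ((max 0 (0 + h))\<^sup>2 - (max 0 0)\<^sup>2) / h) \<longlongrightarrow> 0) (at 0)"
  proof (rule Lim_null_comparison[of _ "\<lambda>h. \<bar>h\<bar>"])
    show "\<forall>\<^sub>F h::real in at 0. norm (((max 0 (0 + h))\<^sup>2 - (max 0 0)\<^sup>2) / h) \<le> \<bar>h\<bar>"
      by (rule always_eventually) (auto simp: max_def power2_eq_square)
    show "((\<lambda>h::real. \<bar>h\<bar>) \<longlongrightarrow> 0) (at 0)" by (intro tendsto_rabs_zero tendsto_ident_at)
  qed
  then show ?thesis using equal by (simp add: DERIV_def)
qed

lemma truncated_square_c1_splines: "(\<lambda>x. (max 0 x)\<^sup>2) \<in> c1_splines"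
proof -
  have "(\<lambda>x::real. (max 0 x)\<^sup>2) C1_differentiable_on UNIV"
    unfolding C1_differentiable_on_def
    by (intro exI[of _ "\<lambda>x. 2 * max 0 x"])
      (auto simp flip: has_real_derivative_iff_has_vector_derivative intro!: DERIV_truncated_square continuous_intros)
  then show ?thesis using cubic_spline_truncated_power[of 2] by (simp add: c1_splines_def)
qed

text \<open>The cube is the truncated square times the untruncated \<open>x\<close>; the truncated
  first power has a corner at 0 and could not serve as a factor.\<close>

lemma truncated_cube_c1_splines: "(\<lambda>x. max 0 x ^ 3) \<in> c1_splines"
proof -
  have "(\<lambda>x::real. (max 0 x)\<^sup>2 * x) C1_differentiable_on UNIV"
    using truncated_square_c1_splines by (intro C1_differentiable_on_mult) (auto simp: c1_splines_def)
  moreover have "(\<lambda>x::real. (max 0 x)\<^sup>2 * x) = (\<lambda>x. max 0 x ^ 3)"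
    by (auto simp: fun_eq_iff max_def power2_eq_square power3_eq_cube)
  ultimately show ?thesis using cubic_spline_truncated_power[of 3] by (simp add: c1_splines_def)
qed

text \<open>The terms at each of the knots -1, 0, 1 are the difference of the two adjoining
  polynomial pieces, expanded at that knot. They begin with degree 2 because the pieces agree there
  to first order.\<close>

lemma hermite_truncated_powers:
  "xi1 x = 3 * (max 0 (x + 1))\<^sup>2 - 2 * max 0 (x + 1) ^ 3 + 4 * max 0 x ^ 3
     - 3 * (max 0 (x - 1))\<^sup>2 - 2 * max 0 (x - 1) ^ 3"
  "xi2 x = max 0 (x + 1) ^ 3 - (max 0 (x + 1))\<^sup>2 - 4 * (max 0 x)\<^sup>2
     - max 0 (x - 1) ^ 3 - (max 0 (x - 1))\<^sup>2"
proof -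
  consider "x < -1" | "-1 \<le> x" "x \<le> 0" | "0 < x" "x \<le> 1" | "1 < x" by linarith
  note cases = this
  show "xi1 x = 3 * (max 0 (x + 1))\<^sup>2 - 2 * max 0 (x + 1) ^ 3 + 4 * max 0 x ^ 3
     - 3 * (max 0 (x - 1))\<^sup>2 - 2 * max 0 (x - 1) ^ 3"
    by (rule cases) (simp_all add: xi1_def max_def, simp_all add: power2_eq_square power3_eq_cube algebra_simps)
  show "xi2 x = max 0 (x + 1) ^ 3 - (max 0 (x + 1))\<^sup>2 - 4 * (max 0 x)\<^sup>2
     - max 0 (x - 1) ^ 3 - (max 0 (x - 1))\<^sup>2"
    by (rule cases) (simp_all add: xi2_def max_def, simp_all add: power2_eq_square power3_eq_cube algebra_simps)
qed

lemma hermite_c1_splines: "xi1 \<in> c1_splines" "xi2 \<in> c1_splines"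
proof -
  let ?p = "\<lambda>d n x. max 0 (1 * x + d) ^ n :: real"
  have p: "?p d 2 \<in> c1_splines" "?p d 3 \<in> c1_splines" for d
    using c1_splines_affine[OF truncated_square_c1_splines, of 1 d]
      c1_splines_affine[OF truncated_cube_c1_splines, of 1 d] by simp_all
  note intros = subspace_add[OF subspace_c1_splines] subspace_diff[OF subspace_c1_splines]
    subspace_scale[OF subspace_c1_splines] p
  have "xi1 = 3 *\<^sub>R ?p 1 2 - 2 *\<^sub>R ?p 1 3 + 4 *\<^sub>R ?p 0 3 - 3 *\<^sub>R ?p (- 1) 2 - 2 *\<^sub>R ?p (- 1) 3"
    by (simp add: fun_eq_iff hermite_truncated_powers)
  also have "\<dots> \<in> c1_splines" by (intro intros)
  finally show "xi1 \<in> c1_splines" .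
  have "xi2 = ?p 1 3 - ?p 1 2 - 4 *\<^sub>R ?p 0 2 - ?p (- 1) 3 - ?p (- 1) 2"
    by (simp add: fun_eq_iff hermite_truncated_powers)
  also have "\<dots> \<in> c1_splines" by (intro intros)
  finally show "xi2 \<in> c1_splines" .
qed

section \<open>The Hermite spaces\<close>

lemma hermite_supported: "xi1 \<in> supported (- 1) 1" "xi2 \<in> supported (- 1) 1"
  by (auto simp: supported_def xi1_def xi2_def)

lemma hermite_minus: "xi1 (- x) = xi1 x" "xi2 (- x) = - xi2 x"
  by (auto simp: xi1_def xi2_def power2_eq_square algebra_simps)

lemma xi_even: "xi j (2 * k) x = 2 powr (of_int j / 2) * xi1 (2 powi j * x - of_int k)"
  by (simp add: xi_def)

lemma xi_odd: "xi j (2 * k + 1) x = 2 powr (of_int j / 2) * xi2 (2 powi j * x - of_int k)"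
  by (simp add: xi_def)

lemma int_parity_cases:
  obtains k where "m = 2 * k" | k where "m = 2 * k + (1::int)"
  by (meson evenE oddE)

lemma dil_xi: "dil i (xi j m) = xi (i + j) m"
  by (cases m rule: int_parity_cases; hypsubst; simp only: fun_eq_iff dil_def xi_even xi_odd)
    (simp_all add: power_int_add powr_add add_divide_distrib mult_ac)

text \<open>At level \<open>p\<close> there are \<open>2 ^ p\<close> knots per unit and two
  functions per knot, which explains the index shift. The level is a natural number because on
  coarser grids an integer shift need not map knots to knots.\<close>

lemma translate_xi: "translate k (xi (int p) m) = xi (int p) (m + 2 ^ (p + 1) * k)"
proof (cases m rule: int_parity_cases)
  case (1 n)
  then have "m + 2 ^ (p + 1) * k = 2 * (n + 2 ^ p * k)" by simp
  then show ?thesis unfolding 1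
    by (simp only: fun_eq_iff translate_def xi_even) (simp add: algebra_simps)
next
  case (2 n)
  then have "m + 2 ^ (p + 1) * k = 2 * (n + 2 ^ p * k) + 1" by simp
  then show ?thesis unfolding 2
    by (simp only: fun_eq_iff translate_def xi_odd) (simp add: algebra_simps)
qed

lemma xi_c1_splines: "xi j m \<in> c1_splines"
proof -
  have "xi 0 m = translate (m div 2) (if even m then xi1 else xi2)"
    by (simp add: fun_eq_iff xi_def translate_def)
  then have "xi 0 m \<in> c1_splines" using c1_splines_translate hermite_c1_splines by simp
  from c1_splines_dil[OF this, of j] show ?thesis by (simp add: dil_xi)
qed

lemma xi_continuous: "continuous_on UNIV (xi j m)"
  by (rule c1_splines_continuous[OF xi_c1_splines])

lemma xi_0_supported: "xi 0 m \<in> supported (of_int (m div 2) - 1) (of_int (m div 2) + 1)"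
  by (auto simp: supported_def xi_def supportedD[OF hermite_supported(1)] supportedD[OF hermite_supported(2)])

lemma xi_L2: "xi j m \<in> L2"
  using dil_L2[OF continuous_supported_L2[OF xi_continuous xi_0_supported], of j m]
  by (simp add: dil_xi)

lemma xi_supported:
  assumes "c * 2 powi j \<le> of_int (m div 2) - 1" "of_int (m div 2) + 1 \<le> d * 2 powi j"
  shows "xi j m \<in> supported c d"
proof -
  have "xi j m x = 0" if "x < c \<or> d < x" for x
  proof -
    have "2 powi j * x - of_int (m div 2) < -1 \<or> 1 < 2 powi j * x - of_int (m div 2)"
      using that
    proof
      assume "x < c"
      then have "2 powi j * x < c * 2 powi j" by (simp add: mult.commute)
      then show ?thesis using assms(1) by linarith
    next
      assume "d < x"
      then have "d * 2 powi j < 2 powi j * x" by (simp add: mult.commute)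
      then show ?thesis using assms(2) by linarith
    qed
    then show ?thesis
      using supportedD[OF hermite_supported(1)] supportedD[OF hermite_supported(2)]
      by (auto simp: xi_def)
  qed
  then show ?thesis by (auto simp: supported_def)
qed

text \<open>Hermite interpolation on the half-integer grid: the coefficient of
  \<open>xi1 (2 * x - k)\<close> is the value at \<open>k / 2\<close>, that of
  \<open>xi2 (2 * x - k)\<close> is half the derivative there.\<close>

lemma hermite_refinement:
  "xi1 x = xi1 (2 * x) + xi1 (2 * x - 1) / 2 + xi1 (2 * x + 1) / 2
     - 3 / 4 * xi2 (2 * x - 1) + 3 / 4 * xi2 (2 * x + 1)"
  "xi2 x = xi2 (2 * x) / 2 + xi1 (2 * x - 1) / 8 - xi1 (2 * x + 1) / 8
     - xi2 (2 * x - 1) / 8 - xi2 (2 * x + 1) / 8"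
proof -
  consider "x < -1" | "-1 \<le> x" "x < -1/2" | "x = -1/2" | "-1/2 < x" "x < 0" | "x = 0" | "0 < x" "x < 1/2"
    | "x = 1/2" | "1/2 < x" "x \<le> 1" | "1 < x" by linarith
  note cases = this
  show "xi1 x = xi1 (2 * x) + xi1 (2 * x - 1) / 2 + xi1 (2 * x + 1) / 2
     - 3 / 4 * xi2 (2 * x - 1) + 3 / 4 * xi2 (2 * x + 1)"
    by (rule cases; hypsubst?; simp add: xi1_def xi2_def; simp?; simp add: power2_eq_square field_simps)
  show "xi2 x = xi2 (2 * x) / 2 + xi1 (2 * x - 1) / 8 - xi1 (2 * x + 1) / 8
     - xi2 (2 * x - 1) / 8 - xi2 (2 * x + 1) / 8"
    by (rule cases; hypsubst?; simp add: xi1_def xi2_def; simp?; simp add: power2_eq_square field_simps)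
qed

lemma xi_refinement_span: "xi j m \<in> span (range (xi (j + 1)))"
proof -
  note intros = span_add span_diff span_scale span_base rangeI
  have s: "2 powr (1 / 2) > (0::real)" by simp
  have "xi 0 m \<in> span (range (xi 1))"
  proof (cases m rule: int_parity_cases)
    case (1 k)
    have "xi 0 m = (1 / 2 powr (1 / 2)) *\<^sub>R (xi 1 (2 * (2 * k)) + (1/2) *\<^sub>R xi 1 (2 * (2 * k + 1))
       + (1/2) *\<^sub>R xi 1 (2 * (2 * k - 1)) - (3/4) *\<^sub>R xi 1 (2 * (2 * k + 1) + 1) + (3/4) *\<^sub>R xi 1 (2 * (2 * k - 1) + 1))"
      using s unfolding 1
      by (simp only: fun_eq_iff xi_even xi_odd plus_fun_apply minus_apply scaleR_fun_apply)
        (simp add: hermite_refinement(1)[of "_ - of_int k"], simp add: field_simps)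
    also have "\<dots> \<in> span (range (xi 1))" by (intro intros)
    finally show ?thesis .
  next
    case (2 k)
    have "xi 0 m = (1 / 2 powr (1 / 2)) *\<^sub>R ((1/2) *\<^sub>R xi 1 (2 * (2 * k) + 1) + (1/8) *\<^sub>R xi 1 (2 * (2 * k + 1))
       - (1/8) *\<^sub>R xi 1 (2 * (2 * k - 1)) - (1/8) *\<^sub>R xi 1 (2 * (2 * k + 1) + 1) - (1/8) *\<^sub>R xi 1 (2 * (2 * k - 1) + 1))"
      using s unfolding 2
      by (simp only: fun_eq_iff xi_even xi_odd plus_fun_apply minus_apply scaleR_fun_apply)
        (simp add: hermite_refinement(2)[of "_ - of_int k"], simp add: field_simps)
    also have "\<dots> \<in> span (range (xi 1))" by (intro intros)
    finally show ?thesis .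
  qed
  \<comment> \<open>Dilation carries the relation between levels 0 and 1 to levels \<open>j\<close>
    and \<open>j + 1\<close>.\<close>
  then have "dil j (xi 0 m) \<in> dil j ` span (range (xi 1))" by blast
  then show ?thesis by (simp add: linear_span_image[OF linear_dil, symmetric] image_image dil_xi)
qed

section \<open>Partition of unity by translates of \<open>xi1\<close>, and approximation of
  indicators\<close>

lemma xi1_nonneg: "0 \<le> xi1 x"
  by (auto simp: xi1_def)

lemma xi1_partition: "0 \<le> x \<Longrightarrow> x \<le> 1 \<Longrightarrow> xi1 x + xi1 (x - 1) = 1"
  by (cases "x = 0"; cases "x = 1") (simp_all add: xi1_def power2_eq_square algebra_simps)

text \<open>The translate by \<open>k\<close> vanishes unless \<open>y\<close> is strictly between
  \<open>k - 1\<close> and \<open>k + 1\<close>, which leaves at most the two integers next to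
  \<open>y\<close>.\<close>

lemma sum_xi1_translates:
  assumes "finite K"
  shows "(\<Sum>k\<in>K. xi1 (y - of_int k))
    = (if \<lfloor>y\<rfloor> \<in> K then xi1 (y - of_int \<lfloor>y\<rfloor>) else 0) + (if \<lfloor>y\<rfloor> + 1 \<in> K then xi1 (y - of_int \<lfloor>y\<rfloor> - 1) else 0)"
proof -
  have "xi1 (y - of_int k) = (if k = \<lfloor>y\<rfloor> then xi1 (y - of_int \<lfloor>y\<rfloor>) else 0)
      + (if k = \<lfloor>y\<rfloor> + 1 then xi1 (y - of_int \<lfloor>y\<rfloor> - 1) else 0)" for k
  proof -
    consider "k = \<lfloor>y\<rfloor>" | "k = \<lfloor>y\<rfloor> + 1" | "k < \<lfloor>y\<rfloor>" | "k > \<lfloor>y\<rfloor> + 1" by linarith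
    then show ?thesis
    proof cases
      case 3
      then have "y - of_int k \<ge> 1" by linarith
      then have "xi1 (y - of_int k) = 0" by (auto simp: xi1_def)
      then show ?thesis using 3 by simp
    next
      case 4
      then have "y - of_int k < - 1" by linarith
      then have "xi1 (y - of_int k) = 0" by (auto simp: xi1_def)
      then show ?thesis using 4 by simp
    qed (simp_all add: algebra_simps)
  qed
  then show ?thesis using assms by (simp add: sum.distrib)
qed

lemma sum_xi1_translates_bounds:
  assumes "finite K"
  shows "0 \<le> (\<Sum>k\<in>K. xi1 (y - of_int k))" "(\<Sum>k\<in>K. xi1 (y - of_int k)) \<le> 1"
proof -
  show "0 \<le> (\<Sum>k\<in>K. xi1 (y - of_int k))" by (intro sum_nonneg xi1_nonneg)
  have "xi1 (y - of_int \<lfloor>y\<rfloor>) + xi1 (y - of_int \<lfloor>y\<rfloor> - 1) = 1"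
    by (rule xi1_partition) linarith+
  then show "(\<Sum>k\<in>K. xi1 (y - of_int k)) \<le> 1"
    unfolding sum_xi1_translates[OF assms]
    using xi1_nonneg[of "y - of_int \<lfloor>y\<rfloor>"] xi1_nonneg[of "y - of_int \<lfloor>y\<rfloor> - 1"] by auto
qed

text \<open>The margin 1 at both ends ensures that both relevant integers belong to the index
  range.\<close>

lemma sum_xi1_translates_interval:
  assumes "r + 1 \<le> y" "y + 1 \<le> s"
  shows "(\<Sum>k\<in>{\<lceil>r\<rceil>..\<lfloor>s\<rfloor>}. xi1 (y - of_int k)) = 1"
proof -
  have "\<lfloor>y\<rfloor> \<in> {\<lceil>r\<rceil>..\<lfloor>s\<rfloor>}" "\<lfloor>y\<rfloor> + 1 \<in> {\<lceil>r\<rceil>..\<lfloor>s\<rfloor>}"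
    using assms by (auto simp: ceiling_le_iff le_floor_iff) linarith+
  then show ?thesis
    using sum_xi1_translates[of "{\<lceil>r\<rceil>..\<lfloor>s\<rfloor>}" y] xi1_partition[of "y - of_int \<lfloor>y\<rfloor>"] by simp linarith
qed

lemma sum_xi1_translates_interval_0:
  assumes "y + 1 < r \<or> s + 1 < y"
  shows "(\<Sum>k\<in>{\<lceil>r\<rceil>..\<lfloor>s\<rfloor>}. xi1 (y - of_int k)) = 0"
proof -
  have "\<lfloor>y\<rfloor> \<notin> {\<lceil>r\<rceil>..\<lfloor>s\<rfloor>}" "\<lfloor>y\<rfloor> + 1 \<notin> {\<lceil>r\<rceil>..\<lfloor>s\<rfloor>}"
    using assms by (auto simp: ceiling_le_iff le_floor_iff) linarith+
  then show ?thesis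
    by (simp only: sum_xi1_translates[OF finite_atLeastAtMost_int] if_False add_0_left)
qed

lemma eventually_power_mult_gt_1:
  fixes d :: real
  assumes "d > 0"
  shows "eventually (\<lambda>n. 1 < 2 ^ n * d) sequentially"
proof -
  obtain N where N: "1 / d < 2 ^ N" using real_arch_pow[of 2 "1 / d"] by auto
  show ?thesis
  proof (rule eventually_sequentiallyI[of N])
    fix n assume "N \<le> n"
    then have "(2::real) ^ N \<le> 2 ^ n" by (simp add: power_increasing)
    then have "1 / d < 2 ^ n" using N by linarith
    then show "1 < 2 ^ n * d" using assms by (simp add: field_simps)
  qed
qed

text \<open>Summing the functions centred at the grid points of \<open>{a..b}\<close> gives values
  in [0, 1] that differ from the indicator only within distance \<open>1 / 2 ^ n\<close> of
  \<open>a\<close> or \<open>b\<close>. So there is convergence at every point other than these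
  two.\<close>

lemma indicator_in_closed_spline_space:
  assumes D: "closed_l2_subspace D" and xi: "\<And>n m. xi (int n) m \<in> D" and ab: "a \<le> b"
  shows "indicator {a..b} \<in> D"
proof -
  have sub: "subspace D" and clo: "l2_closure D = D" using D by (auto simp: closed_l2_subspace_def)
  define s where "s n = (\<lambda>x. \<Sum>k\<in>{\<lceil>2 ^ n * a\<rceil>..\<lfloor>2 ^ n * b\<rfloor>}. xi1 (2 ^ n * x - of_int k))" for n :: nat
  have "s n = (\<Sum>k\<in>{\<lceil>2 ^ n * a\<rceil>..\<lfloor>2 ^ n * b\<rfloor>}. (1 / 2 powr (of_int (int n) / 2)) *\<^sub>R xi (int n) (2 * k))" for n
    by (simp only: fun_eq_iff s_def sum_fun_apply scaleR_fun_apply xi_even) simp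
  then have sD: "s n \<in> D" for n
    using xi by (simp only:) (intro subspace_sum[OF sub] subspace_scale[OF sub])
  then have sL: "s n \<in> L2" for n
    using clo l2_closure_subset_L2 by blast
  have s01: "0 \<le> s n x" "s n x \<le> 1" for n x
    unfolding s_def by (intro sum_xi1_translates_bounds; simp)+
  have out: "s n x = 0" if "1 < 2 ^ n * (a - x) \<or> 1 < 2 ^ n * (x - b)" for n x
    unfolding s_def using that by (intro sum_xi1_translates_interval_0) (auto simp: algebra_simps)
  have ins: "s n x = 1" if "1 < 2 ^ n * (x - a) \<and> 1 < 2 ^ n * (b - x)" for n x
    unfolding s_def using that by (intro sum_xi1_translates_interval) (auto simp: algebra_simps)
  have "indicator {a..b} \<in> l2_closure D"
  proof (rule l2_closure_sequentialI[OF indicator_Icc_L2 sD sL])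
    show "(\<lambda>n. l2_norm (indicator {a..b} - s n)) \<longlonglongrightarrow> 0"
    proof (rule l2_norm_dominated_tendsto_0[OF sL indicator_Icc_L2 indicator_Icc_L2])
      have "AE x in lborel. x \<noteq> a \<and> x \<noteq> b"
        using AE_lborel_singleton[of a] AE_lborel_singleton[of b] by eventually_elim simp
      then show "AE x in lborel. (\<lambda>n. s n x) \<longlonglongrightarrow> indicator {a..b} x"
      proof eventually_elim
        case (elim x)
        then consider "x < a" | "b < x" | "a < x" "x < b" by linarith
        then have "eventually (\<lambda>n. s n x = indicator {a..b} x) sequentially"
        proof cases
          case 1
          then show ?thesis using eventually_power_mult_gt_1[of "a - x"] out by (auto elim!: eventually_mono)
        next
          case 2
          then show ?thesis using eventually_power_mult_gt_1[of "x - b"] out by (auto elim!: eventually_mono)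
        next
          case 3
          then have "eventually (\<lambda>n. 1 < 2 ^ n * (x - a) \<and> 1 < 2 ^ n * (b - x)) sequentially"
            using eventually_power_mult_gt_1[of "x - a"] eventually_power_mult_gt_1[of "b - x"]
            by (auto intro: eventually_conj)
          then show ?thesis by (rule eventually_mono) (use 3 ins in auto)
        qed
        then show ?case by (rule tendsto_eventually)
      qed
      \<comment> \<open>The sums reach at most \<open>1 / 2 ^ n\<close>, hence at most 1, beyond
        \<open>{a..b}\<close>, so one majorant serves all \<open>n\<close>.\<close>
      show "AE x in lborel. \<bar>s n x - indicator {a..b} x\<bar> \<le> \<bar>indicator {a - 1..b + 1} x\<bar>" for n
      proof (rule AE_I2)
        fix x :: real
        have one: "(1::real) \<le> 2 ^ n" by simp
        show "\<bar>s n x - indicator {a..b} x\<bar> \<le> \<bar>indicator {a - 1..b + 1} x\<bar>"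
        proof (cases "x \<in> {a - 1..b + 1}")
          case True
          then show ?thesis using s01[of n x] by (auto simp: indicator_def)
        next
          case False
          then consider "1 < a - x" | "1 < x - b" by fastforce
          then have "1 < 2 ^ n * (a - x) \<or> 1 < 2 ^ n * (x - b)"
          proof cases
            case 1
            then have "1 * (a - x) \<le> 2 ^ n * (a - x)" by (intro mult_right_mono one) simp
            with 1 show ?thesis by (metis less_le_trans mult_1)
          next
            case 2
            then have "1 * (x - b) \<le> 2 ^ n * (x - b)" by (intro mult_right_mono one) simp
            with 2 show ?thesis by (metis less_le_trans mult_1)
          qed
          then show ?thesis using out False ab by (auto simp: indicator_def)
        qed
      qed
    qed
  qed
  then show ?thesis using clo by simp
qed

section \<open>The generators\<close>

text \<open>Once differentiability is known, a formula on one side determines the derivative. Here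
  \<open>c\<close> may be an endpoint of the interval, so derivatives at knots can be read off from
  a single polynomial piece.\<close>

lemma has_vector_derivative_from_interval:
  assumes "f differentiable at c" "(r has_vector_derivative D) (at c)"
    and "a < b" "c \<in> {a..b}" "\<And>x. x \<in> {a..b} \<Longrightarrow> f x = r x"
  shows "(f has_vector_derivative D) (at c)"
proof -
  obtain E where E: "(f has_vector_derivative E) (at c)"
    using assms(1) vector_derivative_works by blast
  have "(f has_vector_derivative D) (at c within {a..b})"
    by (rule has_vector_derivative_transform[OF assms(4) _ has_vector_derivative_at_within[OF assms(2)]])
      (use assms(5) in simp)
  then have "E = D"
    using vector_derivative_unique_within_closed_interval[of a b c f E D] assms(3,4) E
      has_vector_derivative_at_within by (metis cbox_interval)
  then show ?thesis using E by simp
qed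

lemma c1_splines_differentiable: "f \<in> c1_splines \<Longrightarrow> f differentiable at c"
  by (simp add: c1_splines_def C1_differentiable_on_eq)

text \<open>On one side of \<open>c\<close> the function is zero, and continuity and
  differentiability extend this to value and derivative at \<open>c\<close>.\<close>

lemma supported_endpoint_derivative:
  assumes "f \<in> c1_splines" "f \<in> supported a b" "c \<le> a \<or> b \<le> c"
  shows "f c = 0" "(f has_vector_derivative 0) (at c)"
proof -
  have f0: "f x = 0" if "x < a \<or> b < x" for x using supportedD[OF assms(2) that] .
  have cont: "isCont f c"
    using c1_splines_continuous[OF assms(1)] by (simp add: continuous_on_eq_continuous_at)
  \<comment> \<open>The point \<open>c\<close> is exempted: \<open>supported\<close> permits a
    nonzero value at an endpoint.\<close>
  have "\<exists>d e. d < e \<and> c \<in> {d..e} \<and> (\<forall>x\<in>{d..e}. x \<noteq> c \<longrightarrow> f x = 0)"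
    using assms(3)
  proof
    assume "c \<le> a"
    then show ?thesis using f0 by (intro exI[of _ "c - 1"] exI[of _ c]) auto
  next
    assume "b \<le> c"
    then show ?thesis using f0 by (intro exI[of _ c] exI[of _ "c + 1"]) auto
  qed
  then obtain d e where de: "d < e" "c \<in> {d..e}" "\<And>x. x \<in> {d..e} \<Longrightarrow> x \<noteq> c \<Longrightarrow> f x = 0" by blast
  have "(f \<longlongrightarrow> f c) (at c within {d..e})"
    using cont by (simp add: isCont_def tendsto_within_subset[of _ _ _ UNIV])
  moreover have "(f \<longlongrightarrow> 0) (at c within {d..e})"
    by (rule tendsto_eventually) (use de in \<open>auto simp: eventually_at_filter\<close>)
  moreover have "at c within {d..e} \<noteq> bot"
    using de by (simp add: trivial_limit_within islimpt_Icc)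
  ultimately show z: "f c = 0" by (metis tendsto_unique)
  show "(f has_vector_derivative 0) (at c)"
    by (rule has_vector_derivative_from_interval[OF c1_splines_differentiable[OF assms(1)],
          where r = "\<lambda>_. 0" and a = d and b = e])
      (use de z in auto)
qed

text \<open>The derivative of \<open>xi2\<close> at 0 is 1; the argument \<open>2 * x\<close>
  contributes 2 and the normalisation the root of 2.\<close>

lemma xi_1_1_derivative: "(xi 1 1 has_vector_derivative 2 * 2 powr (1/2)) (at 0)"
proof (rule has_vector_derivative_from_interval[OF c1_splines_differentiable[OF xi_c1_splines]])
  show "((\<lambda>x. 2 powr (1/2) * ((1 - 2 * x)\<^sup>2 * (2 * x))) has_vector_derivative 2 * 2 powr (1/2)) (at 0)"
    unfolding has_real_derivative_iff_has_vector_derivative[symmetric]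
    by (auto intro!: derivative_eq_intros)
  show "xi 1 1 x = 2 powr (1/2) * ((1 - 2 * x)\<^sup>2 * (2 * x))" if "x \<in> {0..1/2}" for x
    using that by (cases "x = 0") (auto simp: xi_def xi2_def)
qed auto

lemma sum_1_4: "(\<Sum>j=1..4. f j) = f 1 + f 2 + f 3 + f (4::nat)" for f :: "nat \<Rightarrow> 'a :: comm_monoid_add"
  by (simp add: numeral_eq_Suc add_ac)

lemma sum_1_5: "(\<Sum>j=1..5. f j) = (\<Sum>j=1..4. f j) + f (5::nat)" for f :: "nat \<Rightarrow> 'a :: comm_monoid_add"
  by (simp add: numeral_eq_Suc)

text \<open>Indices 2 and 3 at level 1 belong to the knot 1/2, and the functions extend 1/2 to
  either side.\<close>

lemma A0_subset: "A0 \<subseteq> L2 \<inter> c1_splines \<inter> supported 0 1"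
  unfolding A0_def
proof (rule span_minimal)
  show "{xi 1 2, xi 1 3} \<subseteq> L2 \<inter> c1_splines \<inter> supported 0 1"
    by (auto simp: xi_L2 xi_c1_splines intro!: xi_supported)
qed (intro subspace_inter subspace_L2 subspace_c1_splines subspace_supported)

text \<open>Indices 2 to 7 at level 2 belong to the knots 1/4, 1/2, 3/4, and the functions extend
  1/4 to either side.\<close>

lemma A1_subset: "A1 \<subseteq> L2 \<inter> c1_splines \<inter> supported 0 1"
  unfolding A1_def
proof (rule span_minimal)
  have "xi 2 m \<in> supported 0 1" if "m \<in> {2..7}" for m :: int
  proof (rule xi_supported)
    have "1 \<le> m div 2" "m div 2 \<le> 3" using that by auto
    then show "0 * 2 powi 2 \<le> real_of_int (m div 2) - 1" "of_int (m div 2) + 1 \<le> (1::real) * 2 powi 2"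
      by simp_all
  qed
  then show "xi 2 ` {2..7} \<subseteq> L2 \<inter> c1_splines \<inter> supported 0 1"
    by (auto simp: xi_L2 xi_c1_splines)
qed (intro subspace_inter subspace_L2 subspace_c1_splines subspace_supported)

lemma A1_subset_span: "A1 \<subseteq> span (range (xi 2))"
  unfolding A1_def by (rule span_mono) auto

text \<open>Under the reflection of [0, 1] about 1/2 one function is even and the other odd, so the
  integral equals its own negative.\<close>

lemma xi_1_2_xi_1_3_orthogonal: "l2_inner (xi 1 2) (xi 1 3) = 0"
proof -
  have r: "xi 1 2 (1 - x) = xi 1 2 x" "xi 1 3 (1 - x) = - xi 1 3 x" for x
    using hermite_minus[of "2 * x - 1"] by (simp_all add: xi_def algebra_simps)
  have "l2_inner (xi 1 2) (xi 1 3) = (LINT x|lborel. xi 1 2 (1 + (-1) * x) * xi 1 3 (1 + (-1) * x))"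
    unfolding l2_inner_def
    using lborel_integral_real_affine[of "-1" "\<lambda>x. xi 1 2 x * xi 1 3 x" 1] by simp
  also have "\<dots> = - l2_inner (xi 1 2) (xi 1 3)"
    by (simp add: r l2_inner_def)
  finally show ?thesis by simp
qed

lemma l2_norm_xi_1_pos: "l2_norm (xi 1 2) > 0" "l2_norm (xi 1 3) > 0"
proof -
  have "xi 1 2 (1/2) \<noteq> 0" by (simp add: xi_def xi1_def)
  then show "l2_norm (xi 1 2) > 0" by (rule l2_norm_continuous_pos[OF xi_L2 xi_continuous])
  \<comment> \<open>The centre 1/2 is a zero of this function, so a point beside it is
    tested.\<close>
  have "xi 1 3 (3/4) \<noteq> 0" by (simp add: xi_def xi2_def)
  then show "l2_norm (xi 1 3) > 0" by (rule l2_norm_continuous_pos[OF xi_L2 xi_continuous])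
qed

section \<open>Functions on [-1, 1] cut at 0 into two halves over the unit interval\<close>

lemma restrict01_L2: "continuous_on UNIV f \<Longrightarrow> restrict01 f \<in> L2"
  using continuous_restrict_L2[of f 0 1] by (simp add: restrict01_def[abs_def])

lemma restrict01_supported: "restrict01 f \<in> supported 0 1"
  by (auto simp: supported_def restrict01_def)

lemma l2_inner_restrict01: "g \<in> supported 0 1 \<Longrightarrow> l2_inner (restrict01 f) g = l2_inner f g"
proof -
  assume g: "g \<in> supported 0 1"
  then have "(\<lambda>x. restrict01 f x * g x) = (\<lambda>x. f x * g x)"
    by (auto simp: fun_eq_iff supported_def restrict01_def indicator_def)
  then show ?thesis unfolding l2_inner_def by (simp only:)
qed

text \<open>The left half is stored as \<open>q\<close>, moved to [0, 1]. In this way inner products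
  between translates reduce to inner products of functions on one unit interval.\<close>

definition glue :: "(real \<Rightarrow> real) \<Rightarrow> (real \<Rightarrow> real) \<Rightarrow> real \<Rightarrow> real" where
  "glue p q = p + translate (- 1) q"

lemma glue_L2: "p \<in> L2 \<Longrightarrow> q \<in> L2 \<Longrightarrow> glue p q \<in> L2"
  by (simp add: glue_def L2_add translate_L2)

text \<open>Equality may fail at 0, where both halves contribute the value of
  \<open>f\<close>.\<close>

lemma glue_restrict01:
  assumes "f \<in> supported (- 1) 1"
  shows "AE x in lborel. f x = glue (restrict01 f) (restrict01 (translate 1 f)) x"
proof -
  have "AE x in lborel. x \<noteq> (0::real)" by (rule AE_lborel_singleton)
  then show ?thesis
  proof eventually_elim
    case (elim x)
    then show ?case using assms
      by (cases "x \<in> {-1..1}") (auto simp: glue_def translate_def restrict01_def supported_def indicator_def)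
  qed
qed

lemma l2_inner_translate_left: "l2_inner (translate k f) g = l2_inner f (translate (- k) g)"
  using l2_inner_translate[of k f "translate (- k) g"] by (simp add: translate_translate)

lemma l2_inner_glue_translate:
  assumes "p \<in> L2" "q \<in> L2" "p \<in> supported 0 1" "q \<in> supported 0 1" "r \<in> L2" "r \<in> supported 0 1"
  shows "l2_inner (glue p q) (translate n r)
    = (if n = 0 then l2_inner p r else if n = -1 then l2_inner q r else 0)"
  using assms l2_inner_translates_unit[OF assms(3,6), of 0 n] l2_inner_translates_unit[OF assms(4,6), of "- 1" n]
  by (simp add: glue_def l2_inner_add_left translate_L2)

text \<open>A shift by 1 brings the left half \<open>s\<close> over [0, 1], where it meets
  \<open>p\<close>; a shift by -1 brings \<open>r\<close> onto \<open>q\<close>. Larger shifts leave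
  at most a common endpoint. For nonzero shifts, therefore, only right halves paired with left
  halves occur.\<close>

lemma l2_inner_glue_translate_glue:
  assumes pq: "p \<in> L2" "q \<in> L2" "p \<in> supported 0 1" "q \<in> supported 0 1"
    and rs: "r \<in> L2" "s \<in> L2" "r \<in> supported 0 1" "s \<in> supported 0 1"
  shows "l2_inner (glue p q) (translate n (glue r s))
    = (if n = 0 then l2_inner p r + l2_inner q s else if n = 1 then l2_inner p s
       else if n = -1 then l2_inner q r else 0)"
proof -
  have "translate n (glue r s) = translate n r + translate (n - 1) s"
    by (simp add: glue_def linear_add[OF linear_translate] translate_translate)
  then have "l2_inner (glue p q) (translate n (glue r s))
     = l2_inner (glue p q) (translate n r) + l2_inner (glue p q) (translate (n - 1) s)"
    using assms by (simp add: l2_inner_add_right glue_L2 translate_L2)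
  then show ?thesis
    using l2_inner_glue_translate[OF pq rs(1,3), of n] l2_inner_glue_translate[OF pq rs(2,4), of "n - 1"]
    by auto
qed

lemma l2_inner_normalized:
  assumes "l2_norm f > 0"
  shows "l2_inner (f /\<^sub>R l2_norm f) (f /\<^sub>R l2_norm f) = 1"
proof -
  have "l2_inner f f = l2_norm f * l2_norm f"
    using l2_norm_square[of f] by (simp add: power2_eq_square)
  then show ?thesis using assms by (simp add: field_simps)
qed

lemma AE_translate:
  assumes "f \<in> L2" "g \<in> L2" "AE x in lborel. f x = g x"
  shows "AE x in lborel. translate k f x = translate k g x"
proof -
  have "l2_norm (f - g) = 0"
    using assms by (simp add: l2_norm_eq_0_iff_AE L2_diff)
  then have "l2_norm (translate k f - translate k g) = 0"
    by (simp flip: linear_diff[OF linear_translate])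
  then show ?thesis
    using assms by (simp add: l2_norm_eq_0_iff_AE L2_diff translate_L2)
qed

lemma orthogonal_span_zero:
  assumes "f \<in> L2" "S \<subseteq> L2" "\<And>g. g \<in> S \<Longrightarrow> l2_inner f g = 0" "g \<in> span S"
  shows "l2_inner f g = 0"
proof -
  have "span S \<subseteq> {g \<in> L2. l2_inner f g = 0}"
  proof (rule span_minimal)
    show "subspace {g \<in> L2. l2_inner f g = 0}"
      using assms(1) by (auto intro!: subspaceI simp: l2_inner_add_right)
  qed (use assms(2,3) in auto)
  then show ?thesis using assms(4) by blast
qed

text \<open>The construction with \<open>\<phi> j (x + 1)\<close> rewritten as
  \<open>translate (- 1) (\<phi> j)\<close>, so that the algebra of translations applies.\<close>

locale hermite_generators =
  fixes \<phi> :: "nat \<Rightarrow> real \<Rightarrow> real" and W :: "(real \<Rightarrow> real) set" and g5 g6 :: "real \<Rightarrow> real"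
  assumes phi1: "\<phi> 1 = xi 1 2 /\<^sub>R l2_norm (xi 1 2)"
    and phi2: "\<phi> 2 = xi 1 3 /\<^sub>R l2_norm (xi 1 3)"
    and phi34: "orthonormal_system {3, 4} \<phi>"
    and W: "W = span {\<phi> 3, \<phi> 4}"
    and W_sub: "W \<subseteq> A1 \<ominus>\<^sub>2 A0"
    and W_orth: "\<forall>f\<in>C0. \<forall>g\<in>C1. l2_inner (f - l2_proj W f) (g - l2_proj W g) = 0"
    and g5: "g5 = xi 1 0 - (\<Sum>j=1..4. l2_inner (xi 1 0) (\<phi> j) *\<^sub>R \<phi> j)
      - (\<Sum>j=1..4. l2_inner (xi 1 0) (translate (- 1) (\<phi> j)) *\<^sub>R translate (- 1) (\<phi> j))"
    and phi5: "\<phi> 5 = g5 /\<^sub>R l2_norm g5"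
    and g6: "g6 = xi 1 1 - (\<Sum>j=1..5. l2_inner (xi 1 1) (\<phi> j) *\<^sub>R \<phi> j)
      - (\<Sum>j=1..5. l2_inner (xi 1 1) (translate (- 1) (\<phi> j)) *\<^sub>R translate (- 1) (\<phi> j))"
    and phi6: "\<phi> 6 = g6 /\<^sub>R l2_norm g6"
begin

section \<open>The generators \<open>\<phi> 1\<close> to \<open>\<phi> 4\<close> and the residual
  modulo their span\<close>

lemma phi_A0: "\<phi> 1 \<in> A0" "\<phi> 2 \<in> A0"
  unfolding phi1 phi2 A0_def by (intro span_scale span_base; simp)+

lemma phi_A1: "\<phi> 3 \<in> A1" "\<phi> 4 \<in> A1"
  using W W_sub span_base[of _ "{\<phi> 3, \<phi> 4}"] by (auto simp: l2_ominus_def)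

lemma phi_34_orth_A0: "g \<in> A0 \<Longrightarrow> l2_inner (\<phi> 3) g = 0" "g \<in> A0 \<Longrightarrow> l2_inner (\<phi> 4) g = 0"
  using W W_sub span_base[of _ "{\<phi> 3, \<phi> 4}"] by (auto simp: l2_ominus_def)

lemma atLeastAtMost_1_4: "j \<in> {1..4::nat} \<longleftrightarrow> j = 1 \<or> j = 2 \<or> j = 3 \<or> j = 4"
  by auto

lemma phi_4:
  assumes "j \<in> {1..4}"
  shows "\<phi> j \<in> L2" "\<phi> j \<in> c1_splines" "\<phi> j \<in> supported 0 1"
  using assms phi_A0 phi_A1 A0_subset A1_subset unfolding atLeastAtMost_1_4 by blast+

lemma phi_4_inner:
  assumes "i \<in> {1..4}" "j \<in> {1..4}"
  shows "l2_inner (\<phi> i) (\<phi> j) = (if i = j then 1 else 0)"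
proof -
  have "l2_inner (\<phi> 1) (\<phi> 1) = 1" "l2_inner (\<phi> 2) (\<phi> 2) = 1"
    unfolding phi1 phi2 by (rule l2_inner_normalized[OF l2_norm_xi_1_pos(1)] l2_inner_normalized[OF l2_norm_xi_1_pos(2)])+
  moreover have "l2_inner (\<phi> 1) (\<phi> 2) = 0"
    unfolding phi1 phi2 by (simp add: xi_1_2_xi_1_3_orthogonal)
  moreover have "l2_inner (\<phi> 3) (\<phi> 3) = 1" "l2_inner (\<phi> 4) (\<phi> 4) = 1" "l2_inner (\<phi> 3) (\<phi> 4) = 0"
    using phi34 by (auto simp: orthonormal_system_def)
  ultimately show ?thesis
    using assms phi_34_orth_A0 phi_A0 unfolding atLeastAtMost_1_4
    by (elim disjE) (simp_all add: l2_inner_commute[of "\<phi> (Suc 0)" "\<phi> 3"] l2_inner_commute[of "\<phi> (Suc 0)" "\<phi> 4"]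
        l2_inner_commute[of "\<phi> 2" "\<phi> 3"] l2_inner_commute[of "\<phi> 2" "\<phi> 4"]
        l2_inner_commute[of "\<phi> 2" "\<phi> (Suc 0)"] l2_inner_commute[of "\<phi> 4" "\<phi> 3"])
qed

text \<open>The projection is an arbitrary choice, yet equality holds at every point: members of
  \<open>W\<close> are literal combinations of \<open>\<phi> 3\<close> and \<open>\<phi> 4\<close>,
  and orthogonality fixes both coefficients.\<close>

lemma l2_proj_W:
  assumes f: "f \<in> L2"
  shows "l2_proj W f = l2_inner f (\<phi> 3) *\<^sub>R \<phi> 3 + l2_inner f (\<phi> 4) *\<^sub>R \<phi> 4"
proof -
  have L: "\<phi> 3 \<in> L2" "\<phi> 4 \<in> L2" by (auto simp: phi_4)
  have orth: "l2_inner (\<phi> 3) (\<phi> 3) = 1" "l2_inner (\<phi> 4) (\<phi> 4) = 1"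
      "l2_inner (\<phi> 3) (\<phi> 4) = 0" "l2_inner (\<phi> 4) (\<phi> 3) = 0"
    by (simp_all add: phi_4_inner)
  let ?g = "l2_inner f (\<phi> 3) *\<^sub>R \<phi> 3 + l2_inner f (\<phi> 4) *\<^sub>R \<phi> 4"
  have gL: "?g \<in> L2" using L by auto
  have "l2_inner (f - ?g) (\<phi> 3) = 0" "l2_inner (f - ?g) (\<phi> 4) = 0"
    using f L gL by (simp_all add: l2_inner_diff_left l2_inner_add_left L2_scaleR orth)
  then have "\<forall>h\<in>W. l2_inner (f - ?g) h = 0"
    using orthogonal_span_zero[of "f - ?g" "{\<phi> 3, \<phi> 4}"] f L gL by (auto simp: W)
  moreover have "?g \<in> W" unfolding W by (intro span_add span_scale span_base) auto
  ultimately have ex: "?g \<in> W \<and> (\<forall>h\<in>W. l2_inner (f - ?g) h = 0)" by blast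
  have "l2_proj W f \<in> W \<and> (\<forall>h\<in>W. l2_inner (f - l2_proj W f) h = 0)"
    unfolding l2_proj_def by (rule someI[of _ ?g]) (rule ex)
  then have mem: "l2_proj W f \<in> span {\<phi> 3, \<phi> 4}"
      and 0: "l2_inner (f - l2_proj W f) (\<phi> 3) = 0" "l2_inner (f - l2_proj W f) (\<phi> 4) = 0"
    using span_base[of _ "{\<phi> 3, \<phi> 4}"] unfolding W by blast+
  obtain a where "l2_proj W f - a *\<^sub>R \<phi> 3 \<in> span {\<phi> 4}"
    using mem unfolding span_breakdown_eq[of _ "\<phi> 3"] by blast
  then obtain b where "l2_proj W f - a *\<^sub>R \<phi> 3 = b *\<^sub>R \<phi> 4"
    unfolding span_singleton by blast
  then have ab: "l2_proj W f = a *\<^sub>R \<phi> 3 + b *\<^sub>R \<phi> 4"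
    by (metis add.commute diff_add_cancel)
  have "a = l2_inner f (\<phi> 3)" "b = l2_inner f (\<phi> 4)"
    using 0 f L unfolding ab by (simp_all add: l2_inner_diff_left l2_inner_add_left L2_scaleR L2_add orth)
  then show ?thesis using ab by simp
qed

text \<open>The orthogonal projection away from the span of \<open>\<phi> 1\<close> to
  \<open>\<phi> 4\<close>, that is, from \<open>A0\<close> and \<open>W\<close> together.\<close>

definition resid :: "(real \<Rightarrow> real) \<Rightarrow> real \<Rightarrow> real" where
  "resid f = f - (\<Sum>j=1..4. l2_inner f (\<phi> j) *\<^sub>R \<phi> j)"

lemma resid_L2: "f \<in> L2 \<Longrightarrow> resid f \<in> L2"
  unfolding resid_def by (intro L2_diff L2_sum L2_scaleR phi_4)

lemma resid_supported: "f \<in> supported 0 1 \<Longrightarrow> resid f \<in> supported 0 1"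
  unfolding resid_def
  by (intro subspace_diff[OF subspace_supported] subspace_sum[OF subspace_supported]
      subspace_scale[OF subspace_supported] phi_4)

lemma resid_orth:
  assumes "f \<in> L2" "j \<in> {1..4}"
  shows "l2_inner (resid f) (\<phi> j) = 0"
proof -
  have "l2_inner (\<Sum>i=1..4. l2_inner f (\<phi> i) *\<^sub>R \<phi> i) (\<phi> j) = (\<Sum>i=1..4. l2_inner f (\<phi> i) * l2_inner (\<phi> i) (\<phi> j))"
    using assms by (subst l2_inner_sum_left) (auto simp: phi_4)
  also have "\<dots> = (\<Sum>i=1..4. if i = j then l2_inner f (\<phi> j) else 0)"
    using assms by (intro sum.cong) (auto simp: phi_4_inner)
  also have "\<dots> = l2_inner f (\<phi> j)" using assms by simp
  finally show ?thesis
    unfolding resid_def using assms phi_4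
    by (subst l2_inner_diff_left) (auto intro!: L2_sum L2_scaleR)
qed

lemma l2_inner_resid_left:
  assumes "f \<in> L2" "g \<in> L2"
  shows "l2_inner (resid f) (resid g) = l2_inner f (resid g)"
proof -
  have "l2_inner (\<Sum>j=1..4. l2_inner f (\<phi> j) *\<^sub>R \<phi> j) (resid g) = 0"
    using assms resid_orth[OF assms(2)]
    by (subst l2_inner_sum_left) (auto simp: phi_4 resid_L2 l2_inner_commute[of _ "resid g"])
  moreover have "(\<Sum>j=1..4. l2_inner f (\<phi> j) *\<^sub>R \<phi> j) \<in> L2"
    by (intro L2_sum L2_scaleR phi_4)
  moreover have "resid f = f - (\<Sum>j=1..4. l2_inner f (\<phi> j) *\<^sub>R \<phi> j)"
    by (rule resid_def)
  ultimately show ?thesis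
    using assms by (simp add: l2_inner_diff_left resid_L2)
qed

text \<open>This is where \<open>W_orth\<close> enters. The residual is the projection away from
  \<open>A0\<close>, which leads into \<open>C0\<close> or \<open>C1\<close>, followed by the
  projection away from \<open>W\<close>.\<close>

lemma resid_cross:
  assumes "m \<in> {0, 1}" "n \<in> {4, 5}"
  shows "l2_inner (resid (restrict01 (xi 1 m))) (resid (restrict01 (xi 1 n))) = 0"
proof -
  \<comment> \<open>Projection away from \<open>A0\<close>, for which \<open>\<phi> 1\<close> and
    \<open>\<phi> 2\<close> are an orthonormal basis.\<close>
  define h where "h f = f - (l2_inner f (\<phi> 1) *\<^sub>R \<phi> 1 + l2_inner f (\<phi> 2) *\<^sub>R \<phi> 2)" for f
  have L: "\<phi> 1 \<in> L2" "\<phi> 2 \<in> L2" "\<phi> 3 \<in> L2" "\<phi> 4 \<in> L2" by (auto simp: phi_4)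
  have hL: "h f \<in> L2" if "f \<in> L2" for f
    unfolding h_def using that L by auto
  have h_inner: "l2_inner (h f) g = l2_inner f g - (l2_inner f (\<phi> 1) * l2_inner (\<phi> 1) g + l2_inner f (\<phi> 2) * l2_inner (\<phi> 2) g)"
    if "f \<in> L2" "g \<in> L2" for f g
    unfolding h_def using that L by (simp add: l2_inner_diff_left l2_inner_add_left L2_add L2_scaleR)
  \<comment> \<open>Since \<open>\<phi> 3\<close> and \<open>\<phi> 4\<close> are orthogonal to
    \<open>\<phi> 1\<close> and \<open>\<phi> 2\<close>, applying \<open>h\<close> does not change
    the coefficients along them.\<close>
  have resid_h: "resid f = h f - l2_proj W (h f)" if "f \<in> L2" for f
    unfolding l2_proj_W[OF hL[OF that]] using that L
    by (simp add: h_inner phi_4_inner) (unfold resid_def h_def sum_1_4, simp add: algebra_simps)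
  have h_orth: "l2_inner (h f) g = 0" if f: "f \<in> L2" and g: "g \<in> A0" for f g
  proof (rule orthogonal_span_zero[OF hL[OF f]])
    show "g \<in> span {\<phi> 1, \<phi> 2}"
    proof -
      have "xi 1 2 = l2_norm (xi 1 2) *\<^sub>R \<phi> 1" "xi 1 3 = l2_norm (xi 1 3) *\<^sub>R \<phi> 2"
        unfolding phi1 phi2 using l2_norm_xi_1_pos by simp_all
      then have "{xi 1 2, xi 1 3} \<subseteq> span {\<phi> 1, \<phi> 2}"
        by (metis empty_subsetI insertCI insert_subset span_base span_scale)
      then have "A0 \<subseteq> span {\<phi> 1, \<phi> 2}" unfolding A0_def by (rule span_minimal) simp
      then show ?thesis using g by blast
    qed
    show "l2_inner (h f) g = 0" if "g \<in> {\<phi> 1, \<phi> 2}" for g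
      using that f L by (auto simp: h_inner phi_4_inner)
  qed (use L in auto)
  have r: "restrict01 (xi 1 k) \<in> L2" for k by (rule restrict01_L2[OF xi_continuous])
  have "h (restrict01 (xi 1 m)) \<in> B0"
    unfolding h_def B0_def using assms(1) phi_A0
    by (intro span_diff span_add span_scale) (auto intro: span_base)
  then have "h (restrict01 (xi 1 m)) \<in> C0"
    using h_orth[OF r] by (simp add: C0_def l2_ominus_def)
  moreover have "h (restrict01 (xi 1 n)) \<in> B1"
    unfolding h_def B1_def using assms(2) phi_A0
    by (intro span_diff span_add span_scale) (auto intro: span_base)
  then have "h (restrict01 (xi 1 n)) \<in> C1"
    using h_orth[OF r] by (simp add: C1_def l2_ominus_def)
  ultimately show ?thesis using W_orth unfolding resid_h[OF r] by blast
qed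

text \<open>The common part of \<open>g5\<close> and \<open>g6\<close>: components are removed on
  both unit intervals adjacent to 0.\<close>

definition split_resid :: "(real \<Rightarrow> real) \<Rightarrow> real \<Rightarrow> real" where
  "split_resid f = f - (\<Sum>j=1..4. l2_inner f (\<phi> j) *\<^sub>R \<phi> j)
      - (\<Sum>j=1..4. l2_inner f (translate (- 1) (\<phi> j)) *\<^sub>R translate (- 1) (\<phi> j))"

text \<open>Each \<open>\<phi> j\<close> sees only the right half of \<open>f\<close> and each
  shifted one only the left half, so the subtraction acts on the halves separately as
  \<open>resid\<close>.\<close>

lemma split_resid_glue:
  assumes "f \<in> supported (- 1) 1"
  shows "AE x in lborel. split_resid f x = glue (resid (restrict01 f)) (resid (restrict01 (translate 1 f))) x"
proof -
  have c: "l2_inner (restrict01 f) (\<phi> j) = l2_inner f (\<phi> j)"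
    "l2_inner (restrict01 (translate 1 f)) (\<phi> j) = l2_inner f (translate (- 1) (\<phi> j))" if "j \<in> {1..4}" for j
    using phi_4[OF that] by (simp_all add: l2_inner_restrict01 l2_inner_translate_left)
  have "glue (resid (restrict01 f)) (resid (restrict01 (translate 1 f)))
    = glue (restrict01 f) (restrict01 (translate 1 f)) - (\<Sum>j=1..4. l2_inner f (\<phi> j) *\<^sub>R \<phi> j)
      - (\<Sum>j=1..4. l2_inner f (translate (- 1) (\<phi> j)) *\<^sub>R translate (- 1) (\<phi> j))"
    unfolding glue_def resid_def
    by (simp add: c linear_diff[OF linear_translate] linear_sum[OF linear_translate] linear_scale[OF linear_translate])
  then have "glue (resid (restrict01 f)) (resid (restrict01 (translate 1 f))) x
    = glue (restrict01 f) (restrict01 (translate 1 f)) x - (\<Sum>j=1..4. l2_inner f (\<phi> j) *\<^sub>R \<phi> j) x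
      - (\<Sum>j=1..4. l2_inner f (translate (- 1) (\<phi> j)) *\<^sub>R translate (- 1) (\<phi> j)) x" for x
    by (simp only: minus_apply)
  with glue_restrict01[OF assms] show ?thesis
    unfolding split_resid_def by (auto elim!: eventually_mono)
qed

lemma translate_phi_4:
  assumes "j \<in> {1..4}"
  shows "translate (- 1) (\<phi> j) \<in> L2" "translate (- 1) (\<phi> j) \<in> c1_splines"
    "translate (- 1) (\<phi> j) \<in> supported (- 1) 0"
  using phi_4[OF assms] supported_translate[of "\<phi> j" 0 1 "- 1"]
  by (simp_all add: translate_L2 c1_splines_translate)

text \<open>0 is an endpoint of the interval carrying each of these functions.\<close>

lemma phi_4_flat:
  assumes "j \<in> {1..4}"
  shows "\<phi> j 0 = 0" "translate (- 1) (\<phi> j) 0 = 0"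
    "(\<phi> j has_vector_derivative 0) (at 0)" "(translate (- 1) (\<phi> j) has_vector_derivative 0) (at 0)"
  using supported_endpoint_derivative[OF phi_4(2,3), of j 0]
    supported_endpoint_derivative[OF translate_phi_4(2,3), of j 0] assms by simp_all

lemma split_resid_mem:
  assumes "f \<in> L2 \<inter> c1_splines \<inter> supported (- 1) 1"
  shows "split_resid f \<in> L2 \<inter> c1_splines \<inter> supported (- 1) 1"
proof -
  have s: "subspace (L2 \<inter> c1_splines \<inter> supported (- 1) 1)"
    by (intro subspace_inter subspace_L2 subspace_c1_splines subspace_supported)
  show ?thesis
    unfolding split_resid_def
    using assms phi_4 translate_phi_4
    by (intro subspace_diff[OF s] subspace_sum[OF s] subspace_scale[OF s])
      (auto intro: supported_mono[of _ 0 1 "- 1" 1] supported_mono[of _ "- 1" 0 "- 1" 1])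
qed

lemma xi_wide:
  assumes "m \<in> {0, 1}"
  shows "xi 1 m \<in> L2 \<inter> c1_splines \<inter> supported (- 1) 1"
  using assms by (auto simp: xi_L2 xi_c1_splines intro!: xi_supported)

text \<open>Hence the left halves of \<open>xi 1 0\<close> and \<open>xi 1 1\<close>, moved to
  [0, 1], are exactly the restricted functions from which \<open>B1\<close> is built.\<close>

lemma translate_1_xi: "translate 1 (xi 1 0) = xi 1 4" "translate 1 (xi 1 1) = xi 1 5"
  using translate_xi[of 1 1 0] translate_xi[of 1 1 1] by simp_all

section \<open>The generator \<open>\<phi> 5\<close>\<close>

lemma g5_split: "g5 = split_resid (xi 1 0)"
  unfolding g5 split_resid_def ..

lemma g5_mem: "g5 \<in> L2 \<inter> c1_splines \<inter> supported (- 1) 1"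
  unfolding g5_split by (intro split_resid_mem xi_wide) simp

lemma g5_0: "g5 0 = 2 powr (1/2)"
proof -
  have "(\<Sum>j=1..4. l2_inner (xi 1 0) (\<phi> j) *\<^sub>R \<phi> j) 0 = 0"
    "(\<Sum>j=1..4. l2_inner (xi 1 0) (translate (- 1) (\<phi> j)) *\<^sub>R translate (- 1) (\<phi> j)) 0 = 0"
    unfolding sum_fun_apply by (intro sum.neutral ballI; simp only: scaleR_fun_apply phi_4_flat; simp)+
  then have "g5 0 = xi 1 0 0" unfolding g5 minus_apply by (simp only: diff_zero)
  then show ?thesis by (simp add: xi_def xi1_def)
qed

lemma l2_norm_g5_pos: "l2_norm g5 > 0"
  using g5_mem g5_0 by (intro l2_norm_continuous_pos[of _ 0]) (auto intro: c1_splines_continuous)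

lemma phi_5_mem: "\<phi> 5 \<in> L2 \<inter> c1_splines \<inter> supported (- 1) 1"
  unfolding phi5 using g5_mem
  by (intro subspace_scale[OF subspace_inter[OF subspace_inter[OF subspace_L2 subspace_c1_splines] subspace_supported]])

lemma phi_5_inner: "l2_inner (\<phi> 5) (\<phi> 5) = 1"
  unfolding phi5 by (rule l2_inner_normalized[OF l2_norm_g5_pos])

text \<open>The right half of \<open>\<phi> 5\<close>, coming from \<open>B0\<close>; its partner
  \<open>q5\<close> is the left half moved to [0, 1] and comes from \<open>B1\<close>.\<close>

definition p5 :: "real \<Rightarrow> real" where
  "p5 = resid (restrict01 (xi 1 0)) /\<^sub>R l2_norm g5"

definition q5 :: "real \<Rightarrow> real" where
  "q5 = resid (restrict01 (xi 1 4)) /\<^sub>R l2_norm g5"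

lemma resid_xi_mem: "resid (restrict01 (xi 1 m)) \<in> L2" "resid (restrict01 (xi 1 m)) \<in> supported 0 1"
  by (simp_all add: resid_L2 resid_supported restrict01_supported restrict01_L2 xi_continuous)

lemma restrict01_xi_mem: "restrict01 (xi 1 m) \<in> L2" "restrict01 (xi 1 m) \<in> supported 0 1"
  by (simp_all add: restrict01_supported restrict01_L2 xi_continuous)

lemma p5_q5_mem: "p5 \<in> L2" "q5 \<in> L2" "p5 \<in> supported 0 1" "q5 \<in> supported 0 1"
  unfolding p5_def q5_def
  using resid_xi_mem subspace_scale[OF subspace_supported] by (auto simp del: scaleR_fun_apply)

lemma glue_scaleR: "glue (c *\<^sub>R p) (c *\<^sub>R q) = c *\<^sub>R glue p q"
  by (simp add: glue_def linear_scale[OF linear_translate] scaleR_add_right)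

lemma phi_5_glue: "AE x in lborel. \<phi> 5 x = glue p5 q5 x"
proof -
  have "AE x in lborel. g5 x = glue (resid (restrict01 (xi 1 0))) (resid (restrict01 (xi 1 4))) x"
    using split_resid_glue[of "xi 1 0"] xi_wide[of 0] by (simp add: g5_split translate_1_xi)
  then show ?thesis
    unfolding phi5 p5_def q5_def glue_scaleR by eventually_elim simp
qed

lemma phi_5_orth_phi_4:
  assumes "j \<in> {1..4}"
  shows "l2_inner (\<phi> 5) (translate n (\<phi> j)) = 0"
proof -
  note j = phi_4[OF assms]
  have "l2_inner (\<phi> 5) (translate n (\<phi> j)) = l2_inner (glue p5 q5) (translate n (\<phi> j))"
    using phi_5_mem p5_q5_mem j phi_5_glue by (intro l2_inner_cong_AE) (auto simp: glue_L2 translate_L2)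
  also have "\<dots> = 0"
    unfolding l2_inner_glue_translate[OF p5_q5_mem j(1,3)]
    by (simp add: p5_def q5_def resid_orth[OF restrict01_xi_mem(1) assms])
  finally show ?thesis .
qed

text \<open>On [-1, 0] the left half of \<open>xi 1 1\<close> meets the right half of
  \<open>\<phi> 5\<close>, a pairing of type \<open>B1\<close> with \<open>B0\<close>. So the last
  term in the definition of \<open>g6\<close> is 0.\<close>

lemma xi_1_1_inner_translate_phi_5: "l2_inner (xi 1 1) (translate (- 1) (\<phi> 5)) = 0"
proof -
  let ?u = "restrict01 (xi 1 1)" and ?v = "restrict01 (xi 1 5)"
  have "AE x in lborel. xi 1 1 x = glue ?u ?v x"
    using glue_restrict01[of "xi 1 1"] xi_wide[of 1] by (simp add: translate_1_xi)
  then have "l2_inner (xi 1 1) (translate (- 1) (\<phi> 5)) = l2_inner (glue ?u ?v) (translate (- 1) (glue p5 q5))"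
    using phi_5_mem p5_q5_mem AE_translate[OF _ _ phi_5_glue, of "- 1"]
    by (intro l2_inner_cong_AE) (auto simp: glue_L2 translate_L2 xi_L2 restrict01_xi_mem)
  also have "\<dots> = l2_inner ?v p5"
    by (simp add: l2_inner_glue_translate_glue[OF restrict01_xi_mem(1,1,2,2) p5_q5_mem])
  \<comment> \<open>\<open>p5\<close> is already a residual, so taking the residual of the other
    factor as well changes nothing.\<close>
  also have "\<dots> = l2_inner (resid ?v) (resid (restrict01 (xi 1 0))) / l2_norm g5"
    by (simp add: p5_def l2_inner_resid_left restrict01_xi_mem field_simps)
  also have "\<dots> = 0" using resid_cross[of 0 5] by (simp add: l2_inner_commute)
  finally show ?thesis .
qed

section \<open>The generator \<open>\<phi> 6\<close>\<close>

definition c6 :: real where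
  "c6 = l2_inner (xi 1 1) (\<phi> 5)"

lemma g6_split: "g6 = split_resid (xi 1 1) - c6 *\<^sub>R \<phi> 5"
  unfolding g6 split_resid_def sum_1_5 xi_1_1_inner_translate_phi_5 c6_def by simp

lemma g6_mem: "g6 \<in> L2 \<inter> c1_splines \<inter> supported (- 1) 1"
proof -
  have s: "subspace (L2 \<inter> c1_splines \<inter> supported (- 1) 1)"
    by (intro subspace_inter subspace_L2 subspace_c1_splines subspace_supported)
  show ?thesis
    unfolding g6_split
    by (intro subspace_diff[OF s] subspace_scale[OF s] split_resid_mem xi_wide phi_5_mem) simp
qed

text \<open>The functions \<open>\<phi> 1, \<dots>, \<phi> 4\<close> and their shifts vanish to second order at 0, while \<open>\<phi> 5\<close> has a
  nonzero value and \<open>xi 1 1\<close> a nonzero derivative there.\<close>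

lemma l2_norm_g6_pos: "l2_norm g6 > 0"
proof -
  define r where "r = (\<Sum>j=1..4. l2_inner (xi 1 1) (\<phi> j) *\<^sub>R \<phi> j)
      + (\<Sum>j=1..4. l2_inner (xi 1 1) (translate (- 1) (\<phi> j)) *\<^sub>R translate (- 1) (\<phi> j))"
  have r0: "r 0 = 0"
    unfolding r_def plus_fun_apply sum_fun_apply scaleR_fun_apply
    by (simp add: phi_4_flat del: One_nat_def)
  have rd: "(r has_vector_derivative 0) (at 0)"
  proof -
    have "((\<lambda>x. (\<Sum>j=1..4. l2_inner (xi 1 1) (\<phi> j) *\<^sub>R \<phi> j x)
      + (\<Sum>j=1..4. l2_inner (xi 1 1) (translate (- 1) (\<phi> j)) *\<^sub>R translate (- 1) (\<phi> j) x)) has_vector_derivative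
      (\<Sum>j\<in>{1..4::nat}. l2_inner (xi 1 1) (\<phi> j) *\<^sub>R 0) + (\<Sum>j\<in>{1..4::nat}. l2_inner (xi 1 1) (translate (- 1) (\<phi> j)) *\<^sub>R 0)) (at 0)"
      by (intro has_vector_derivative_add has_vector_derivative_sum
          bounded_linear.has_vector_derivative[OF bounded_linear_scaleR_right] phi_4_flat)
    moreover have "r = (\<lambda>x. (\<Sum>j=1..4. l2_inner (xi 1 1) (\<phi> j) *\<^sub>R \<phi> j x)
      + (\<Sum>j=1..4. l2_inner (xi 1 1) (translate (- 1) (\<phi> j)) *\<^sub>R translate (- 1) (\<phi> j) x))"
      by (simp only: fun_eq_iff r_def plus_fun_apply sum_fun_apply scaleR_fun_apply) simp
    ultimately show ?thesis by simp
  qed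
  have g6_r: "g6 = xi 1 1 - r - c6 *\<^sub>R \<phi> 5"
    unfolding g6_split split_resid_def r_def by (simp add: algebra_simps)
  have "\<exists>x. g6 x \<noteq> 0"
  proof (rule ccontr)
    assume "\<not> ?thesis"
    \<comment> \<open>At 0 this identity forces \<open>c6 = 0\<close>; comparing derivatives at 0
      then gives a contradiction.\<close>
    then have zero: "xi 1 1 x = r x + c6 * \<phi> 5 x" for x
    proof -
      have "(xi 1 1 - r - c6 *\<^sub>R \<phi> 5) x = 0" using \<open>\<not> _\<close> g6_r by metis
      then show ?thesis by (simp add: algebra_simps)
    qed
    have "\<phi> 5 0 \<noteq> 0" using g5_0 l2_norm_g5_pos by (simp add: phi5)
    moreover have "xi 1 1 0 = 0" by (simp add: xi_def xi2_def)
    ultimately have "c6 = 0" using zero[of 0] r0 by simp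
    then have "xi 1 1 = r" using zero by (simp add: fun_eq_iff)
    then have "2 * 2 powr (1/2) = (0::real)"
      using rd xi_1_1_derivative vector_derivative_unique_at by metis
    then show False by simp
  qed
  then obtain x where "g6 x \<noteq> 0" by blast
  then show ?thesis
    using g6_mem by (intro l2_norm_continuous_pos) (auto intro: c1_splines_continuous)
qed

lemma phi_6_mem: "\<phi> 6 \<in> L2 \<inter> c1_splines \<inter> supported (- 1) 1"
  unfolding phi6 using g6_mem
  by (intro subspace_scale[OF subspace_inter[OF subspace_inter[OF subspace_L2 subspace_c1_splines] subspace_supported]])

lemma phi_6_inner: "l2_inner (\<phi> 6) (\<phi> 6) = 1"
  unfolding phi6 by (rule l2_inner_normalized[OF l2_norm_g6_pos])

text \<open>\<open>c6\<close> is the coefficient of the original \<open>xi 1 1\<close>, but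
  \<open>split_resid\<close> leaves it unchanged because \<open>\<phi> 5\<close> is orthogonal to
  everything subtracted there.\<close>

lemma phi_5_phi_6_orth: "l2_inner (\<phi> 5) (\<phi> 6) = 0"
proof -
  have t0: "l2_inner (\<phi> 5) (\<phi> j) = 0" if "j \<in> {1..4}" for j
    using phi_5_orth_phi_4[OF that, of 0] by simp
  have L: "\<phi> 5 \<in> L2" "xi 1 1 \<in> L2" "split_resid (xi 1 1) \<in> L2"
    using phi_5_mem xi_L2 split_resid_mem[OF xi_wide[of 1]] by auto
  have SL: "(\<Sum>j=1..4. l2_inner (xi 1 1) (\<phi> j) *\<^sub>R \<phi> j) \<in> L2"
    "(\<Sum>j=1..4. l2_inner (xi 1 1) (translate (- 1) (\<phi> j)) *\<^sub>R translate (- 1) (\<phi> j)) \<in> L2"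
    by (intro L2_sum L2_scaleR phi_4 translate_phi_4; assumption)+
  have S: "l2_inner (\<phi> 5) (\<Sum>j=1..4. l2_inner (xi 1 1) (\<phi> j) *\<^sub>R \<phi> j) = 0"
    using L by (subst l2_inner_sum_right) (auto simp: t0 phi_4)
  have T: "l2_inner (\<phi> 5) (\<Sum>j=1..4. l2_inner (xi 1 1) (translate (- 1) (\<phi> j)) *\<^sub>R translate (- 1) (\<phi> j)) = 0"
    using L by (subst l2_inner_sum_right) (auto simp: phi_5_orth_phi_4 translate_phi_4)
  have "l2_inner (\<phi> 5) (split_resid (xi 1 1)) = c6"
    unfolding split_resid_def c6_def using L SL S T
    by (simp add: l2_inner_diff_right L2_diff l2_inner_commute del: One_nat_def)
  then have "l2_inner (\<phi> 5) g6 = 0"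
    unfolding g6_split using L by (simp add: l2_inner_diff_right L2_scaleR phi_5_inner)
  then show ?thesis unfolding phi6 by simp
qed

text \<open>Subtracting a multiple of \<open>p5\<close> stays within residuals from
  \<open>B0\<close>, just as \<open>q6\<close> stays within those from \<open>B1\<close>.\<close>

definition p6 :: "real \<Rightarrow> real" where
  "p6 = (resid (restrict01 (xi 1 1)) - c6 *\<^sub>R p5) /\<^sub>R l2_norm g6"

definition q6 :: "real \<Rightarrow> real" where
  "q6 = (resid (restrict01 (xi 1 5)) - c6 *\<^sub>R q5) /\<^sub>R l2_norm g6"

lemma p6_q6_mem: "p6 \<in> L2" "q6 \<in> L2" "p6 \<in> supported 0 1" "q6 \<in> supported 0 1"
  unfolding p6_def q6_def
  by (intro L2_scaleR L2_diff subspace_scale[OF subspace_supported] subspace_diff[OF subspace_supported]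
      p5_q5_mem resid_xi_mem)+

lemma phi_6_glue: "AE x in lborel. \<phi> 6 x = glue p6 q6 x"
proof -
  have AE: "AE x in lborel. split_resid (xi 1 1) x = glue (resid (restrict01 (xi 1 1))) (resid (restrict01 (xi 1 5))) x"
    using split_resid_glue[of "xi 1 1"] xi_wide[of 1] by (simp add: translate_1_xi)
  have g6_x: "g6 x = split_resid (xi 1 1) x - c6 * \<phi> 5 x" for x
    by (simp add: g6_split)
  show ?thesis
    using AE phi_5_glue unfolding phi6 p6_def q6_def glue_scaleR
    by eventually_elim (simp add: g6_x glue_def translate_def algebra_simps)
qed

section \<open>Orthonormality of all integer translates\<close>

definition right_half :: "nat \<Rightarrow> real \<Rightarrow> real" where
  "right_half i = (if i = 5 then p5 else p6)"

definition left_half :: "nat \<Rightarrow> real \<Rightarrow> real" where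
  "left_half i = (if i = 5 then q5 else q6)"

text \<open>Every index other than 5 is sent to the halves of \<open>\<phi> 6\<close>, so facts
  about halves need no premise on \<open>i\<close>; only \<open>phi_glue_halves\<close> ties them to
  \<open>\<phi> i\<close>.\<close>

lemma halves_mem: "right_half i \<in> L2" "left_half i \<in> L2"
    "right_half i \<in> supported 0 1" "left_half i \<in> supported 0 1"
  by (simp_all add: right_half_def left_half_def p5_q5_mem p6_q6_mem)

lemma phi_glue_halves: "i \<in> {5, 6} \<Longrightarrow> AE x in lborel. \<phi> i x = glue (right_half i) (left_half i) x"
  using phi_5_glue phi_6_glue by (auto simp: right_half_def left_half_def)

text \<open>Right halves are combinations of the residuals with indices 0 and 1, left halves of
  those with indices 4 and 5, so the four cases of \<open>resid_cross\<close> suffice.\<close>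

lemma halves_cross: "l2_inner (right_half i) (left_half k) = 0"
proof -
  have cross: "l2_inner (resid (restrict01 (xi 1 0))) (resid (restrict01 (xi 1 4))) = 0"
    "l2_inner (resid (restrict01 (xi 1 0))) (resid (restrict01 (xi 1 5))) = 0"
    "l2_inner (resid (restrict01 (xi 1 1))) (resid (restrict01 (xi 1 4))) = 0"
    "l2_inner (resid (restrict01 (xi 1 1))) (resid (restrict01 (xi 1 5))) = 0"
    using resid_cross by auto
  have c1: "l2_inner p5 q5 = 0" "l2_inner (resid (restrict01 (xi 1 1))) q5 = 0"
      "l2_inner p5 (resid (restrict01 (xi 1 5))) = 0"
    unfolding p5_def q5_def by (simp_all add: cross)
  have c2: "l2_inner p5 q6 = 0" "l2_inner p6 q5 = 0"
    unfolding p6_def q6_def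
    by (simp_all add: c1 p5_q5_mem resid_xi_mem l2_inner_diff_left l2_inner_diff_right L2_scaleR)
  have c3: "l2_inner p6 q6 = 0"
    unfolding p6_def q6_def
    by (simp add: c1 cross p5_q5_mem resid_xi_mem l2_inner_diff_left l2_inner_diff_right L2_scaleR L2_diff)
  show ?thesis
    using c1 c2 c3 by (auto simp: right_half_def left_half_def)
qed

lemma halves_orth:
  assumes "j \<in> {1..4}"
  shows "l2_inner (right_half i) (\<phi> j) = 0" "l2_inner (left_half i) (\<phi> j) = 0"
proof -
  have o5: "l2_inner p5 (\<phi> j) = 0" "l2_inner q5 (\<phi> j) = 0"
    unfolding p5_def q5_def using assms by (simp_all add: resid_orth restrict01_xi_mem)
  have o6: "l2_inner p6 (\<phi> j) = 0" "l2_inner q6 (\<phi> j) = 0"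
    unfolding p6_def q6_def using assms o5 phi_4[OF assms]
    by (simp_all add: l2_inner_diff_left resid_orth restrict01_xi_mem resid_xi_mem p5_q5_mem L2_scaleR)
  show "l2_inner (right_half i) (\<phi> j) = 0" "l2_inner (left_half i) (\<phi> j) = 0"
    using o5 o6 by (auto simp: right_half_def left_half_def)
qed

lemma phi_mem:
  assumes "i \<in> {1..6}"
  shows "\<phi> i \<in> L2" "\<phi> i \<in> c1_splines" "\<phi> i \<in> supported (- 1) 1"
proof -
  have "i \<in> {1..4} \<or> i = 5 \<or> i = 6" using assms by auto
  then have "\<phi> i \<in> L2 \<inter> c1_splines \<inter> supported (- 1) 1"
    using phi_4[of i] phi_5_mem phi_6_mem supported_mono[of "\<phi> i" 0 1 "- 1" 1] by auto
  then show "\<phi> i \<in> L2" "\<phi> i \<in> c1_splines" "\<phi> i \<in> supported (- 1) 1" by auto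
qed

lemma phi_translate_inner:
  assumes "i \<in> {1..6}" "k \<in> {1..6}"
  shows "l2_inner (\<phi> i) (translate n (\<phi> k)) = (if i = k \<and> n = 0 then 1 else 0)"
proof -
  have split: "i \<in> {1..4} \<or> i \<in> {5, 6}" if "i \<in> {1..6}" for i :: nat using that by auto
  have mixed: "l2_inner (\<phi> i) (translate n (\<phi> j)) = 0" if "i \<in> {5, 6}" "j \<in> {1..4}" for i j n
  proof -
    have "l2_inner (\<phi> i) (translate n (\<phi> j)) = l2_inner (glue (right_half i) (left_half i)) (translate n (\<phi> j))"
      using that phi_mem(1)[of i] phi_4(1)[of j] phi_glue_halves[OF that(1)]
      by (intro l2_inner_cong_AE) (auto simp: glue_L2 translate_L2 halves_mem)
    also have "\<dots> = 0"
      using phi_4[OF that(2)] halves_orth[OF that(2)] by (simp add: l2_inner_glue_translate halves_mem)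
    finally show ?thesis .
  qed
  have upper: "l2_inner (\<phi> i) (translate n (\<phi> k)) = (if i = k \<and> n = 0 then 1 else 0)"
    if i: "i \<in> {5, 6}" and k: "k \<in> {5, 6}" for i k n
  proof (cases "n = 0")
    \<comment> \<open>Without a shift, right meets right and left meets left, about which
      \<open>halves_cross\<close> says nothing; here orthogonality comes from Gram-Schmidt for the
      whole functions.\<close>
    case True
    then show ?thesis
      using i k phi_5_inner phi_6_inner phi_5_phi_6_orth by (auto simp: l2_inner_commute)
  next
    case False
    have L: "\<phi> i \<in> L2" "\<phi> k \<in> L2" using i k by (auto intro!: phi_mem)
    have "l2_inner (\<phi> i) (translate n (\<phi> k)) = l2_inner (glue (right_half i) (left_half i)) (translate n (glue (right_half k) (left_half k)))"
      using L phi_glue_halves[OF i] AE_translate[OF L(2) _ phi_glue_halves[OF k], of n]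
      by (intro l2_inner_cong_AE) (auto simp: glue_L2 translate_L2 halves_mem)
    also have "\<dots> = 0"
      using False halves_cross
      by (simp add: l2_inner_glue_translate_glue halves_mem l2_inner_commute[of "left_half i"])
    finally show ?thesis using False by simp
  qed
  from split[OF assms(1)] split[OF assms(2)] show ?thesis
  proof (elim disjE)
    assume ik: "i \<in> {1..4}" "k \<in> {1..4}"
    then show ?thesis
      using l2_inner_translates_unit[of "\<phi> i" "\<phi> k" 0 n] phi_4_inner[OF ik] by (auto simp: phi_4)
  next
    assume ik: "i \<in> {1..4}" "k \<in> {5, 6}"
    have "l2_inner (\<phi> i) (translate n (\<phi> k)) = l2_inner (\<phi> k) (translate (- n) (\<phi> i))"
      by (subst l2_inner_commute) (rule l2_inner_translate_left)
    then show ?thesis using mixed[OF ik(2,1)] ik by auto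
  next
    assume ik: "i \<in> {5, 6}" "k \<in> {1..4}"
    then show ?thesis using mixed[OF ik] by auto
  qed (rule upper)
qed

section \<open>The multiresolution analysis\<close>

definition generators :: "(real \<Rightarrow> real) set" where
  "generators = integer_translates \<phi> ` ({1..6} \<times> UNIV)"

lemma integer_translates_eq: "integer_translates \<phi> (i, k) = translate k (\<phi> i)"
  by (simp add: integer_translates_def translate_def fun_eq_iff)

lemma generators_cases:
  assumes "g \<in> generators"
  obtains i k where "i \<in> {1..6}" "g = translate k (\<phi> i)"
  using assms by (auto simp: generators_def integer_translates_eq)

lemma translate_phi_generators: "i \<in> {1..6} \<Longrightarrow> translate k (\<phi> i) \<in> generators"
  unfolding generators_def by (force simp: integer_translates_eq[symmetric])

lemma generators_L2: "generators \<subseteq> L2"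
  by (auto elim!: generators_cases simp: phi_mem translate_L2)

lemma span_generators_L2: "span generators \<subseteq> L2"
  by (rule span_minimal[OF generators_L2 subspace_L2])

lemma orthonormal_generators: "orthonormal_system ({1..6} \<times> UNIV) (integer_translates \<phi>)"
proof -
  have "l2_inner (translate k (\<phi> i)) (translate n (\<phi> j)) = (if i = j \<and> k = n then 1 else 0)"
    if "i \<in> {1..6}" "j \<in> {1..6}" for i j k n
    using phi_translate_inner[OF that, of "n - k"] by (simp add: l2_inner_translate_left translate_translate)
  then show ?thesis
    using generators_L2 by (auto simp: orthonormal_system_def generators_def integer_translates_eq)
qed

lemma scaling_fun_eq:
  "scaling_fun \<phi> j m = dil j (translate ((m - 1) div 6 + (if (m - 1) mod 6 < 4 then 0 else 1)) (\<phi> (nat ((m - 1) mod 6) + 1)))"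
proof -
  have "nat ((m - 1) mod 6) + 1 \<le> 4 \<longleftrightarrow> (m - 1) mod 6 < 4"
    using pos_mod_sign[of 6 "m - 1"] by linarith
  then show ?thesis
    by (simp add: fun_eq_iff scaling_fun_def Let_def dil_def translate_def algebra_simps del: One_nat_def)
qed

text \<open>The extra unit shift for the fifth and sixth function only relabels the
  translates.\<close>

lemma range_scaling_fun: "range (scaling_fun \<phi> j) = dil j ` generators"
proof
  have "nat ((m - 1) mod 6) + 1 \<in> {1..6}" for m :: int
    using pos_mod_bound[of 6 "m - 1"] by auto
  then show "range (scaling_fun \<phi> j) \<subseteq> dil j ` generators"
    unfolding scaling_fun_eq using translate_phi_generators by auto
  show "dil j ` generators \<subseteq> range (scaling_fun \<phi> j)"
  proof (clarify elim!: generators_cases)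
    fix i k assume i: "i \<in> {1..6::nat}"
    \<comment> \<open>The numbering solved for the index, with the extra shift undone for
      \<open>i = 5\<close> and \<open>i = 6\<close>.\<close>
    define m where "m = 6 * (k - (if i \<le> 4 then 0 else 1)) + int i"
    have "m - 1 = (int i - 1) + (k - (if i \<le> 4 then 0 else 1)) * 6" by (simp add: m_def)
    then have "(m - 1) div 6 = (k - (if i \<le> 4 then 0 else 1)) + (int i - 1) div 6" "(m - 1) mod 6 = (int i - 1) mod 6"
      by (simp_all only: div_mult_self1 mod_mult_self1)
    moreover have "(int i - 1) div 6 = 0" "(int i - 1) mod 6 = int i - 1"
      using i by auto
    ultimately have "(m - 1) div 6 + (if (m - 1) mod 6 < 4 then 0 else 1) = k" "nat ((m - 1) mod 6) + 1 = i"
      using i by auto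
    then have "dil j (translate k (\<phi> i)) = scaling_fun \<phi> j m"
      unfolding scaling_fun_eq by simp
    then show "dil j (translate k (\<phi> i)) \<in> range (scaling_fun \<phi> j)" by blast
  qed
qed

lemma scaling_space_eq: "scaling_space \<phi> j = dil j ` l2_closure (span generators)"
  by (simp add: scaling_space_def range_scaling_fun l2_closure_span_dil)

section \<open>Comparison with the spans of the Hermite cubics\<close>

lemma span_range_xi: "span (range (xi (i + j))) = dil i ` span (range (xi j))"
proof -
  have "range (xi (i + j)) = dil i ` range (xi j)" by (simp add: image_image dil_xi)
  then show ?thesis by (simp add: linear_span_image[OF linear_dil])
qed

lemma translate_span_generators:
  assumes "f \<in> span generators"
  shows "translate k f \<in> span generators"
proof -
  have "translate k f \<in> span (translate k ` generators)"
    using assms by (simp add: linear_span_image[OF linear_translate])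
  moreover have "translate k ` generators \<subseteq> generators"
    by (auto elim!: generators_cases simp: translate_translate translate_phi_generators)
  ultimately show ?thesis using span_mono by blast
qed

lemma phi_span_generators:
  assumes "i \<in> {1..6}"
  shows "\<phi> i \<in> span generators" "translate k (\<phi> i) \<in> span generators"
  using translate_phi_generators[OF assms, of 0] translate_phi_generators[OF assms, of k]
  by (simp_all add: span_base)

text \<open>The definitions of \<open>\<phi> 1\<close>, \<open>\<phi> 2\<close>,
  \<open>\<phi> 5\<close> and \<open>\<phi> 6\<close> can be solved for \<open>xi 1 0\<close> to
  \<open>xi 1 3\<close>, as all normalising factors are positive. Integer translation shifts the
  index by 4 and yields the rest.\<close>

lemma xi_span_generators: "range (xi 1) \<subseteq> span generators"
proof -
  have sums: "(\<Sum>j=1..4. c j *\<^sub>R \<phi> j) \<in> span generators"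
    "(\<Sum>j=1..4. c j *\<^sub>R translate (- 1) (\<phi> j)) \<in> span generators" for c :: "nat \<Rightarrow> real"
    by (intro span_sum span_scale phi_span_generators; simp)+
  have scaled: "f \<in> span generators" if "f /\<^sub>R c \<in> span generators" "c > 0" for f c
    using span_scale[OF that(1), of c] that(2) by simp
  have "xi 1 0 \<in> span generators"
  proof -
    have "g5 \<in> span generators"
      by (rule scaled[OF _ l2_norm_g5_pos], fold phi5, rule phi_span_generators) simp
    then have "g5 + (\<Sum>j=1..4. l2_inner (xi 1 0) (translate (- 1) (\<phi> j)) *\<^sub>R translate (- 1) (\<phi> j))
        + (\<Sum>j=1..4. l2_inner (xi 1 0) (\<phi> j) *\<^sub>R \<phi> j) \<in> span generators"
      by (intro span_add sums)
    then show ?thesis unfolding g5 by simp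
  qed
  moreover have "xi 1 1 \<in> span generators"
  proof -
    have "g6 \<in> span generators"
      by (rule scaled[OF _ l2_norm_g6_pos], fold phi6, rule phi_span_generators) simp
    then have "g6 + c6 *\<^sub>R \<phi> 5 + (\<Sum>j=1..4. l2_inner (xi 1 1) (translate (- 1) (\<phi> j)) *\<^sub>R translate (- 1) (\<phi> j))
        + (\<Sum>j=1..4. l2_inner (xi 1 1) (\<phi> j) *\<^sub>R \<phi> j) \<in> span generators"
      by (intro span_add span_scale sums phi_span_generators) simp_all
    then show ?thesis unfolding g6_split split_resid_def by simp
  qed
  moreover have "xi 1 2 \<in> span generators"
    by (rule scaled[OF _ l2_norm_xi_1_pos(1)], fold phi1, rule phi_span_generators) simp
  moreover have "xi 1 3 \<in> span generators"
    by (rule scaled[OF _ l2_norm_xi_1_pos(2)], fold phi2, rule phi_span_generators) simp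
  ultimately have base: "xi 1 r \<in> span generators" if "r \<in> {0..3}" for r
  proof -
    have "r = 0 \<or> r = 1 \<or> r = 2 \<or> r = 3" using that by auto
    with \<open>xi 1 0 \<in> _\<close> \<open>xi 1 1 \<in> _\<close> \<open>xi 1 2 \<in> _\<close> \<open>xi 1 3 \<in> _\<close> show ?thesis by blast
  qed
  have "xi 1 m \<in> span generators" for m
  proof -
    have "xi 1 m = translate (m div 4) (xi 1 (m mod 4))"
      using translate_xi[of "m div 4" 1 "m mod 4"] by simp
    then show ?thesis using translate_span_generators[OF base[of "m mod 4"]] by auto
  qed
  then show ?thesis by blast
qed

lemma translate_span_xi:
  assumes "f \<in> span (range (xi (int p)))"
  shows "translate k f \<in> span (range (xi (int p)))"
proof -
  have "translate k f \<in> span (translate k ` range (xi (int p)))"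
    using assms by (simp add: linear_span_image[OF linear_translate])
  moreover have "translate k ` range (xi (int p)) \<subseteq> range (xi (int p))"
    by (auto simp: translate_xi)
  ultimately show ?thesis using span_mono by blast
qed

text \<open>Level 2 is used because \<open>\<phi> 3\<close> and \<open>\<phi> 4\<close> lie in
  \<open>A1\<close>; everything else is built from level 1 and these two.\<close>

lemma generators_span_xi: "generators \<subseteq> span (range (xi 2))"
proof -
  have tr: "translate k f \<in> span (range (xi 2))" if "f \<in> span (range (xi 2))" for k f
    using translate_span_xi[of f 2 k] that by simp
  have x: "xi 1 m \<in> span (range (xi 2))" for m
    using xi_refinement_span[of 1 m] by simp
  have A0: "A0 \<subseteq> span (range (xi 2))"
    unfolding A0_def by (rule span_minimal) (use x in auto)
  have phi_1_4: "\<phi> j \<in> span (range (xi 2))" if "j \<in> {1..4}" for j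
    using that phi_A0 phi_A1 A0 A1_subset_span unfolding atLeastAtMost_1_4 by blast
  have split: "split_resid (xi 1 m) \<in> span (range (xi 2))" for m
    unfolding split_resid_def by (intro span_diff span_sum span_scale x tr phi_1_4)
  have phi_5: "\<phi> 5 \<in> span (range (xi 2))"
    unfolding phi5 g5_split by (intro span_scale split)
  have phi_6: "\<phi> 6 \<in> span (range (xi 2))"
    unfolding phi6 g6_split by (intro span_scale span_diff split phi_5)
  have "\<phi> i \<in> span (range (xi 2))" if "i \<in> {1..6}" for i
  proof -
    have "i \<in> {1..4} \<or> i = 5 \<or> i = 6" using that by auto
    then show ?thesis using phi_1_4 phi_5 phi_6 by blast
  qed
  then show ?thesis using tr by (auto elim!: generators_cases)
qed

text \<open>The upper Hermite bound at scale \<open>j\<close> and the lower one at scale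
  \<open>j + 1\<close> are the same Hermite level \<open>j + 2\<close>.\<close>

lemma span_generators_dil_subset: "dil j ` span generators \<subseteq> dil (j + 1) ` span generators"
proof -
  have "span generators \<subseteq> span (range (xi 2))"
    using generators_span_xi by (rule span_minimal) simp
  then have "dil j ` span generators \<subseteq> dil j ` span (range (xi 2))" by blast
  also have "\<dots> = dil (j + 1) ` span (range (xi 1))"
    using span_range_xi[of j 2] span_range_xi[of "j + 1" 1] by (simp add: add.assoc)
  also have "\<dots> \<subseteq> dil (j + 1) ` span generators"
    using xi_span_generators by (intro image_mono span_minimal) simp_all
  finally show ?thesis .
qed

lemma scaling_space_mono_step: "scaling_space \<phi> j \<subseteq> scaling_space \<phi> (j + 1)"
  unfolding scaling_space_eq l2_closure_dil[symmetric]
  by (rule l2_closure_mono[OF span_generators_dil_subset])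

lemma scaling_space_mono: "i \<le> j \<Longrightarrow> scaling_space \<phi> i \<subseteq> scaling_space \<phi> j"
  by (induction j rule: int_ge_induct) (use scaling_space_mono_step in auto)

section \<open>The axioms of a multiresolution analysis\<close>

lemma closed_scaling_space: "closed_l2_subspace (scaling_space \<phi> j)"
  unfolding scaling_space_def by (rule closed_l2_subspace_closure_span)

lemma Vtilde_1_subset: "Vtilde 1 \<subseteq> scaling_space \<phi> 0"
  unfolding Vtilde_def scaling_space_def range_scaling_fun
  using xi_span_generators by (intro l2_closure_mono span_minimal) (simp_all add: image_def)

lemma scaling_space_0_subset: "scaling_space \<phi> 0 \<subseteq> Vtilde 2"
  unfolding Vtilde_def scaling_space_def range_scaling_fun
  using generators_span_xi by (intro l2_closure_mono span_minimal) (simp_all add: image_def)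

text \<open>The plain dilation differs from \<open>dil (- j)\<close> by a nonzero scalar, which a
  subspace absorbs.\<close>

lemma scaling_space_dil_iff:
  "f \<in> scaling_space \<phi> j \<longleftrightarrow> (\<lambda>x. f (2 powi (- j) * x)) \<in> scaling_space \<phi> 0"
proof -
  have sub: "subspace (scaling_space \<phi> 0)"
    using closed_scaling_space by (simp add: closed_l2_subspace_def)
  have "f \<in> scaling_space \<phi> j \<longleftrightarrow> dil (- j) f \<in> scaling_space \<phi> 0"
  proof
    assume "f \<in> scaling_space \<phi> j"
    then show "dil (- j) f \<in> scaling_space \<phi> 0" by (auto simp: scaling_space_eq dil_dil)
  next
    assume "dil (- j) f \<in> scaling_space \<phi> 0"
    then have "dil j (dil (- j) f) \<in> scaling_space \<phi> j" by (auto simp: scaling_space_eq)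
    then show "f \<in> scaling_space \<phi> j" by (simp add: dil_dil)
  qed
  moreover have "dil (- j) f = 2 powr (- of_int j / 2) *\<^sub>R (\<lambda>x. f (2 powi (- j) * x))"
    by (simp add: fun_eq_iff dil_def)
  ultimately show ?thesis
    using subspace_scale[OF sub, of "\<lambda>x. f (2 powi (- j) * x)" "2 powr (- of_int j / 2)"]
      subspace_scale[OF sub, of "dil (- j) f" "2 powr (of_int j / 2)"]
    by (auto simp: powr_minus simp flip: powr_add)
qed

lemma scaling_space_dense: "l2_closure (\<Union>j. scaling_space \<phi> j) = L2"
proof (rule closed_l2_subspace_eq_L2)
  have sub: "subspace (scaling_space \<phi> j)" for j
    using closed_scaling_space by (simp add: closed_l2_subspace_def)
  have "subspace (\<Union>j. scaling_space \<phi> j)"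
  proof (rule subspaceI)
    show "0 \<in> (\<Union>j. scaling_space \<phi> j)" using subspace_0[OF sub] by blast
    fix f g assume "f \<in> (\<Union>j. scaling_space \<phi> j)" "g \<in> (\<Union>j. scaling_space \<phi> j)"
    then obtain i j where "f \<in> scaling_space \<phi> i" "g \<in> scaling_space \<phi> j" by blast
    then have "f \<in> scaling_space \<phi> (max i j)" "g \<in> scaling_space \<phi> (max i j)"
      using scaling_space_mono[of i "max i j"] scaling_space_mono[of j "max i j"] by auto
    then show "f + g \<in> (\<Union>j. scaling_space \<phi> j)" using subspace_add[OF sub] by blast
  next
    fix c f assume "f \<in> (\<Union>j. scaling_space \<phi> j)"
    then show "c *\<^sub>R f \<in> (\<Union>j. scaling_space \<phi> j)" using subspace_scale[OF sub] by blast
  qed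
  then show closed: "closed_l2_subspace (l2_closure (\<Union>j. scaling_space \<phi> j))"
    by (simp add: closed_l2_subspace_def subspace_l2_closure l2_closure_idem)
  have xi: "xi (int n) m \<in> l2_closure (\<Union>j. scaling_space \<phi> j)" for n m
  proof -
    have "xi (int n) m = dil (int n - 1) (xi 1 m)" by (simp add: dil_xi)
    moreover have "xi 1 m \<in> l2_closure (span generators)"
      using xi_span_generators l2_closure_superset[OF span_generators_L2] by blast
    ultimately have "xi (int n) m \<in> scaling_space \<phi> (int n - 1)"
      by (simp add: scaling_space_eq)
    then have "xi (int n) m \<in> (\<Union>j. scaling_space \<phi> j)" by blast
    moreover have "(\<Union>j. scaling_space \<phi> j) \<subseteq> L2"
      using l2_closure_subset_L2 by (auto simp: scaling_space_def)
    ultimately show ?thesis using l2_closure_superset by blast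
  qed
  show "indicator {a..b} \<in> l2_closure (\<Union>j. scaling_space \<phi> j)" if "a \<le> b" for a b
    by (rule indicator_in_closed_spline_space[OF closed xi that])
qed

text \<open>At each point only boundedly many translates are nonzero, and the coefficients in an orthonormal
  expansion are bounded by the norm.\<close>

lemma span_generators_sup_bound:
  obtains C where "C > 0" "\<And>s x. s \<in> span generators \<Longrightarrow> \<bar>s x\<bar> \<le> C * l2_norm s"
proof -
  have "\<forall>i\<in>{1..6}. \<exists>M. \<forall>x. \<bar>\<phi> i x\<bar> \<le> M"
    using continuous_supported_bounded[OF c1_splines_continuous[OF phi_mem(2)] phi_mem(3)] by metis
  then obtain B where B: "\<And>i x. i \<in> {1..6} \<Longrightarrow> \<bar>\<phi> i x\<bar> \<le> B i" by metis
  define M where "M = 1 + (\<Sum>i=1..6. \<bar>B i\<bar>)"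
  have M: "\<bar>\<phi> i x\<bar> \<le> M" if "i \<in> {1..6}" for i x
  proof -
    have "\<bar>\<phi> i x\<bar> \<le> \<bar>B i\<bar>" using B[OF that, of x] by linarith
    also have "\<dots> \<le> (\<Sum>i=1..6. \<bar>B i\<bar>)" by (rule member_le_sum[OF that]) auto
    finally show ?thesis by (simp add: M_def)
  qed
  have "M > 0" unfolding M_def by (intro add_pos_nonneg sum_nonneg) auto
  \<comment> \<open>All \<open>k\<close> whose translates can be nonzero at \<open>x\<close> are
    covered, since each \<open>\<phi> i\<close> vanishes outside [-1, 1]; 6 generators and 4 shifts
    give 24.\<close>
  define A :: "real \<Rightarrow> (nat \<times> int) set" where "A x = {1..6} \<times> {\<lfloor>x\<rfloor> - 1..\<lfloor>x\<rfloor> + 2}" for x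
  have finA: "finite (A x)" and cardA: "card (A x) = 24" for x
    by (simp_all add: A_def)
  have expand: "s x = (\<Sum>(i, k)\<in>A x. l2_inner s (translate k (\<phi> i)) * translate k (\<phi> i) x)"
    if "s \<in> span generators" for s x
  proof -
    \<comment> \<open>For fixed \<open>x\<close> the expansion is linear in \<open>s\<close>, so the
      generators suffice. It holds at every point, not just almost everywhere.\<close>
    have "span generators \<subseteq> {s \<in> L2. s x = (\<Sum>(i, k)\<in>A x. l2_inner s (translate k (\<phi> i)) * translate k (\<phi> i) x)}"
    proof (rule span_minimal)
      show "generators \<subseteq> {s \<in> L2. s x = (\<Sum>(i, k)\<in>A x. l2_inner s (translate k (\<phi> i)) * translate k (\<phi> i) x)}"
      proof
        fix g assume g: "g \<in> generators"
        then obtain j n where jn: "j \<in> {1..6}" "g = translate n (\<phi> j)" by (rule generators_cases)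
        have "(\<Sum>(i, k)\<in>A x. l2_inner g (translate k (\<phi> i)) * translate k (\<phi> i) x)
          = (\<Sum>p\<in>A x. if p = (j, n) then g x else 0)"
        proof (rule sum.cong[OF refl], clarify)
          fix i k assume "(i, k) \<in> A x"
          then have "i \<in> {1..6}" by (auto simp: A_def)
          then have "l2_inner g (translate k (\<phi> i)) = (if (i, k) = (j, n) then 1 else 0)"
            using orthonormal_generators jn by (auto simp: orthonormal_system_def integer_translates_eq)
          then show "l2_inner g (translate k (\<phi> i)) * translate k (\<phi> i) x = (if (i, k) = (j, n) then g x else 0)"
            using jn by auto
        qed
        also have "\<dots> = g x"
        proof (cases "(j, n) \<in> A x")
          case False
          then have "n < \<lfloor>x\<rfloor> - 1 \<or> \<lfloor>x\<rfloor> + 2 < n" using jn(1) by (auto simp: A_def)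
          then have "x - of_int n < - 1 \<or> 1 < x - of_int n" by linarith
          then have "g x = 0"
            using supportedD[OF phi_mem(3)[OF jn(1)]] by (simp add: jn(2) translate_def)
          then show ?thesis by (simp add: sum.neutral)
        qed (simp add: finA)
        finally show "g \<in> {s \<in> L2. s x = (\<Sum>(i, k)\<in>A x. l2_inner s (translate k (\<phi> i)) * translate k (\<phi> i) x)}"
          using g generators_L2 by auto
      qed
      have L: "translate k (\<phi> i) \<in> L2" if "(i, k) \<in> A x" for i k
        using that by (auto simp: A_def intro!: translate_L2 phi_mem)
      show "subspace {s \<in> L2. s x = (\<Sum>(i, k)\<in>A x. l2_inner s (translate k (\<phi> i)) * translate k (\<phi> i) x)}"
      proof (rule subspaceI)
        fix f g assume "f \<in> {s \<in> L2. s x = (\<Sum>(i, k)\<in>A x. l2_inner s (translate k (\<phi> i)) * translate k (\<phi> i) x)}"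
          "g \<in> {s \<in> L2. s x = (\<Sum>(i, k)\<in>A x. l2_inner s (translate k (\<phi> i)) * translate k (\<phi> i) x)}"
        moreover from this have "(\<Sum>(i, k)\<in>A x. l2_inner (f + g) (translate k (\<phi> i)) * translate k (\<phi> i) x)
           = (\<Sum>(i, k)\<in>A x. l2_inner f (translate k (\<phi> i)) * translate k (\<phi> i) x)
           + (\<Sum>(i, k)\<in>A x. l2_inner g (translate k (\<phi> i)) * translate k (\<phi> i) x)"
          unfolding sum.distrib[symmetric]
          by (intro sum.cong refl) (auto simp: l2_inner_add_left L distrib_right)
        ultimately show "f + g \<in> {s \<in> L2. s x = (\<Sum>(i, k)\<in>A x. l2_inner s (translate k (\<phi> i)) * translate k (\<phi> i) x)}"
          by auto
      qed (auto simp: case_prod_beta sum_distrib_left mult.assoc)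
    qed
    then show ?thesis using that by blast
  qed
  show ?thesis
  proof (rule that)
    show "24 * M > 0" using \<open>M > 0\<close> by simp
    fix s x assume s: "s \<in> span generators"
    have sL: "s \<in> L2" using s span_generators_L2 by blast
    have "\<bar>s x\<bar> = \<bar>\<Sum>(i, k)\<in>A x. l2_inner s (translate k (\<phi> i)) * translate k (\<phi> i) x\<bar>"
      using expand[OF s, of x] by simp
    also have "\<dots> \<le> (\<Sum>p\<in>A x. \<bar>case p of (i, k) \<Rightarrow> l2_inner s (translate k (\<phi> i)) * translate k (\<phi> i) x\<bar>)"
      by (rule sum_abs)
    also have "\<dots> \<le> (\<Sum>p\<in>A x. l2_norm s * M)"
    proof (rule sum_mono, clarify)
      fix i k assume "(i, k) \<in> A x"
      then have i: "i \<in> {1..6}" by (auto simp: A_def)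
      have "l2_norm (\<phi> i) = 1"
        using phi_translate_inner[OF i i, of 0] by (simp add: l2_norm_def)
      then have "\<bar>l2_inner s (translate k (\<phi> i))\<bar> \<le> l2_norm s"
        using l2_Cauchy_Schwarz[OF sL translate_L2[OF phi_mem(1)[OF i]], of k] by simp
      moreover have "\<bar>translate k (\<phi> i) x\<bar> \<le> M" using M[OF i] by (simp add: translate_def)
      ultimately show "\<bar>l2_inner s (translate k (\<phi> i)) * translate k (\<phi> i) x\<bar> \<le> l2_norm s * M"
        unfolding abs_mult by (intro mult_mono) auto
    qed
    also have "\<dots> = 24 * M * l2_norm s" by (simp add: cardA)
    finally show "\<bar>s x\<bar> \<le> 24 * M * l2_norm s" .
  qed
qed

text \<open>The pointwise bound need not survive limits in norm directly. But the excess
  \<open>r\<close> of \<open>\<bar>h\<bar>\<close> over the bound is dominated by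
  \<open>\<bar>h - s\<bar>\<close> for every sufficiently close \<open>s\<close> in the span, and so
  has norm 0. The slack \<open>d\<close> allows for the norm of \<open>s\<close> exceeding that of
  \<open>h\<close>.\<close>

lemma scaling_space_0_AE_bound:
  assumes C: "C > 0" "\<And>s x. s \<in> span generators \<Longrightarrow> \<bar>s x\<bar> \<le> C * l2_norm s"
    and h: "h \<in> scaling_space \<phi> 0" and d: "d > 0"
  shows "AE x in lborel. \<bar>h x\<bar> \<le> C * (l2_norm h + d)"
proof -
  have h': "h \<in> l2_closure (span generators)" using h by (simp add: scaling_space_eq image_def)
  then have hL: "h \<in> L2" using l2_closure_subset_L2 by blast
  define r where "r x = max 0 (\<bar>h x\<bar> - C * (l2_norm h + d))" for x
  have rL: "r \<in> L2"
  proof (rule L2_bound[OF _ hL])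
    show "r \<in> borel_measurable lborel"
      unfolding r_def using L2_measurable[OF hL] by measurable
    have "0 \<le> C * (l2_norm h + d)" using C(1) d by simp
    then show "\<bar>r x\<bar> \<le> \<bar>h x\<bar>" for x by (simp add: r_def)
  qed
  have "l2_norm r < e" if "e > 0" for e
  proof -
    \<comment> \<open>Distance below \<open>d\<close> keeps the norm of \<open>s\<close> within the
      slack, distance below \<open>e\<close> bounds the norm of \<open>r\<close>.\<close>
    have "min d e > 0" using d that by simp
    then obtain s where s: "s \<in> span generators" "s \<in> L2" "l2_norm (h - s) < min d e"
      using h' unfolding l2_closure_def by blast
    have "l2_norm s \<le> l2_norm h + l2_norm (h - s)"
      using l2_norm_triangle[of h "s - h"] hL s(2) by (simp add: L2_diff l2_norm_minus_commute[of s h])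
    then have "l2_norm s \<le> l2_norm h + d" using s(3) by simp
    then have sb: "\<bar>s x\<bar> \<le> C * (l2_norm h + d)" for x
      using C(2)[OF s(1), of x] C(1) by (meson mult_left_mono order.trans less_imp_le)
    have "\<bar>r x\<bar> \<le> \<bar>(h - s) x\<bar>" for x
      using sb[of x] by (auto simp: r_def)
    then have "(r x)\<^sup>2 \<le> ((h - s) x)\<^sup>2" for x by (simp only: abs_le_square_iff)
    then have "l2_inner r r \<le> l2_inner (h - s) (h - s)"
      unfolding l2_inner_def power2_eq_square[symmetric]
      using rL L2_diff[OF hL s(2)] by (intro integral_mono L2_integrable_square)
    then have "l2_norm r \<le> l2_norm (h - s)" by (simp add: l2_norm_def)
    then show ?thesis using s(3) by simp
  qed
  from this[of "l2_norm r"] have "l2_norm r = 0"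
    using l2_norm_nonneg[of r] by (metis less_irrefl order_le_less)
  then have "AE x in lborel. r x = 0" using l2_norm_eq_0_iff_AE[OF rL] by simp
  then show ?thesis by eventually_elim (simp add: r_def max_def split: if_splits)
qed

text \<open>If \<open>f\<close> lies in every space, dilating the bound on the coarsest ones shows
  \<open>\<bar>f\<bar> \<le> C * 2 powr (- n / 2) * (l2_norm f + 1)\<close> almost everywhere for all \<open>n\<close>.\<close>

lemma scaling_space_Inter: "(\<Inter>j. scaling_space \<phi> j) = {f \<in> L2. AE x in lborel. f x = 0}"
proof
  obtain C where C: "C > 0" "\<And>s x. s \<in> span generators \<Longrightarrow> \<bar>s x\<bar> \<le> C * l2_norm s"
    using span_generators_sup_bound by blast
  show "(\<Inter>j. scaling_space \<phi> j) \<subseteq> {f \<in> L2. AE x in lborel. f x = 0}"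
  proof
    fix f assume f: "f \<in> (\<Inter>j. scaling_space \<phi> j)"
    then have fL: "f \<in> L2" using l2_closure_subset_L2 by (auto simp: scaling_space_def)
    define r where "r n = C * (l2_norm f + 1) * 2 powr (- real n / 2)" for n :: nat
    have "AE x in lborel. \<bar>f x\<bar> \<le> r n" for n
    proof -
      have "f \<in> scaling_space \<phi> (- int n)" using f by blast
      then have "dil (int n) f \<in> scaling_space \<phi> 0"
        by (auto simp: scaling_space_eq dil_dil)
      from scaling_space_0_AE_bound[OF C this zero_less_one]
      have ae: "AE x in lborel. \<bar>dil (int n) f x\<bar> \<le> C * (l2_norm f + 1)" by simp
      have "Measurable.pred borel (\<lambda>x. \<bar>dil (int n) f x\<bar> \<le> C * (l2_norm f + 1))"
        using L2_measurable[OF dil_L2[OF fL, of "int n"]] by measurable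
      \<comment> \<open>At \<open>x / 2 ^ n\<close> the dilated function is
        \<open>2 powr (n / 2) * f x\<close>, and rescaling preserves null sets.\<close>
      from AE_borel_affine[OF _ this ae, of "1 / 2 ^ n" 0]
      have "AE x in lborel. \<bar>dil (int n) f (0 + 1 / 2 ^ n * x)\<bar> \<le> C * (l2_norm f + 1)" by simp
      then show ?thesis
      proof eventually_elim
        case (elim x)
        have "\<bar>f x\<bar> * 2 powr (real n / 2) \<le> C * (l2_norm f + 1)"
          using elim by (simp add: dil_def abs_mult mult.commute)
        moreover have "r n = C * (l2_norm f + 1) / 2 powr (real n / 2)"
          by (simp add: r_def powr_minus_divide)
        ultimately show ?case by (simp add: pos_le_divide_eq)
      qed
    qed
    \<comment> \<open>Countably many exceptional null sets are merged, so that the limit in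
      \<open>n\<close> can be taken at a fixed point.\<close>
    then have "AE x in lborel. \<forall>n. \<bar>f x\<bar> \<le> r n" by (simp add: AE_all_countable)
    then have "AE x in lborel. f x = 0"
    proof eventually_elim
      case (elim x)
      have "2 powr (- real n / 2) = (2 powr (- 1 / 2)) ^ n" for n
        by (simp add: powr_power)
      moreover have "(\<lambda>n. (2 powr (- 1 / 2)) ^ n) \<longlonglongrightarrow> (0::real)"
        by (rule LIMSEQ_power_zero) (simp add: powr_less_one)
      ultimately have "(\<lambda>n. 2 powr (- real n / 2)) \<longlonglongrightarrow> (0::real)" by simp
      then have "r \<longlonglongrightarrow> C * (l2_norm f + 1) * 0" unfolding r_def by (intro tendsto_mult tendsto_const)
      then have "\<bar>f x\<bar> \<le> 0"
        using elim by (intro LIMSEQ_le_const[of r]) auto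
      then show ?case by simp
    qed
    then show "f \<in> {f \<in> L2. AE x in lborel. f x = 0}" using fL by simp
  qed
  show "{f \<in> L2. AE x in lborel. f x = 0} \<subseteq> (\<Inter>j. scaling_space \<phi> j)"
  proof clarify
    fix f j assume "f \<in> L2" "AE x in lborel. f x = 0"
    then have "l2_norm (f - 0) = 0" by (simp add: l2_norm_eq_0_iff_AE)
    moreover have "0 \<in> span (range (scaling_fun \<phi> j)) \<inter> L2" by (simp add: span_zero)
    ultimately show "f \<in> scaling_space \<phi> j"
      using \<open>f \<in> L2\<close> unfolding scaling_space_def l2_closure_def
      by (intro CollectI conjI allI impI bexI[of _ 0]) simp_all
  qed
qed

lemma orthogonal_mra_scaling_space: "orthogonal_mra 6 \<phi> (scaling_space \<phi>)"
proof -
  have onb: "orthonormal_basis_of (scaling_space \<phi> 0) ({1..6} \<times> UNIV) (integer_translates \<phi>)"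
    using orthonormal_generators
    by (simp add: orthonormal_basis_of_def scaling_space_eq generators_def image_def)
  show ?thesis
    unfolding orthogonal_mra_def mra_def
    by (intro conjI allI closed_scaling_space scaling_space_mono_step scaling_space_dil_iff
        scaling_space_dense scaling_space_Inter orthonormal_basis_imp_riesz_basis onb)
qed

lemma scaling_fun_c1_splines: "scaling_fun \<phi> j m \<in> c1_splines"
proof -
  have "scaling_fun \<phi> j m \<in> dil j ` generators" using range_scaling_fun by blast
  then show ?thesis
    by (auto elim!: generators_cases simp: c1_splines_dil c1_splines_translate phi_mem)
qed

end

theorem theorem4:
  fixes \<phi> :: "nat \<Rightarrow> real \<Rightarrow> real" and W :: "(real \<Rightarrow> real) set" and g5 g6 :: "real \<Rightarrow> real"
  assumes phi1: "\<phi> 1 = xi 1 2 /\<^sub>R l2_norm (xi 1 2)"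
    and phi2: "\<phi> 2 = xi 1 3 /\<^sub>R l2_norm (xi 1 3)"
    and phi34: "orthonormal_system {3, 4} \<phi>"
    and W: "W = span {\<phi> 3, \<phi> 4}"
    and W_sub: "W \<subseteq> A1 \<ominus>\<^sub>2 A0"
    and W_orth: "\<forall>f\<in>C0. \<forall>g\<in>C1. l2_inner (f - l2_proj W f) (g - l2_proj W g) = 0"
    and g5: "g5 = xi 1 0 - (\<Sum>j=1..4. l2_inner (xi 1 0) (\<phi> j) *\<^sub>R \<phi> j)
      - (\<Sum>j=1..4. l2_inner (xi 1 0) (\<lambda>x. \<phi> j (x + 1)) *\<^sub>R (\<lambda>x. \<phi> j (x + 1)))"
    and phi5: "\<phi> 5 = g5 /\<^sub>R l2_norm g5"
    and g6: "g6 = xi 1 1 - (\<Sum>j=1..5. l2_inner (xi 1 1) (\<phi> j) *\<^sub>R \<phi> j)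
      - (\<Sum>j=1..5. l2_inner (xi 1 1) (\<lambda>x. \<phi> j (x + 1)) *\<^sub>R (\<lambda>x. \<phi> j (x + 1)))"
    and phi6: "\<phi> 6 = g6 /\<^sub>R l2_norm g6"
  shows "(\<forall>i\<in>{1..6}. cubic_spline (\<phi> i) \<and> \<phi> i C1_differentiable_on UNIV) \<and>
         (\<forall>j k. cubic_spline (scaling_fun \<phi> j k) \<and> scaling_fun \<phi> j k C1_differentiable_on UNIV) \<and>
         orthogonal_mra 6 \<phi> (scaling_space \<phi>) \<and>
         (\<exists>q n :: int. q \<ge> 0 \<and> n \<ge> 1 \<and>
            Vtilde q \<subseteq> scaling_space \<phi> 0 \<and> scaling_space \<phi> 0 \<subseteq> Vtilde (q + n))"
proof -
  have shift: "(\<lambda>x. \<phi> j (x + 1)) = translate (- 1) (\<phi> j)" for j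
    by (simp add: fun_eq_iff translate_def)
  interpret hermite_generators \<phi> W g5 g6
    by (rule hermite_generators.intro[OF phi1 phi2 phi34 W W_sub W_orth g5[unfolded shift] phi5 g6[unfolded shift] phi6])
  have "\<exists>q n :: int. q \<ge> 0 \<and> n \<ge> 1 \<and>
            Vtilde q \<subseteq> scaling_space \<phi> 0 \<and> scaling_space \<phi> 0 \<subseteq> Vtilde (q + n)"
    using Vtilde_1_subset scaling_space_0_subset by (intro exI[of _ 1]) simp
  then show ?thesis
    using phi_mem(2) scaling_fun_c1_splines orthogonal_mra_scaling_space
    by (simp add: c1_splines_def del: atLeastAtMost_iff)
qed

end
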